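(* Let $f_1,f_2$ be invertible elements of $H^\infty$, $g=f_1\overline{f_2}$ on $\mathbb{T}$, let $u,v\in H^2$ with $\|u\|=1$ and $S^*v\ne 0$, and let $R_1f=T_gf+\langle f,u\rangle v$ on $H^2$. Assume $1+\langle f_1^{-1}T_{\overline{f_2}^{-1}}v,u\rangle=0$, so that $M=\ker R_1=\operatorname{span}\{f_1^{-1}T_{\overline{f_2}^{-1}}v\}$ is a nearly $S^*$-invariant subspace with defect $1$ (defect space $\operatorname{span}\{f_1^{-1}T_{\overline{f_2}^{-1}}(S^*v)\}$). Let $\{a_k\}_{k\ge0}$ and $\{b_k\}_{k\ge0}$ be the Taylor coefficients of $T_{\overline{f_2}^{-1}}v$ and $f_1^{-1}$, respectively. (1) If $a_0b_0\neq0$, let $f_0=P_M1=\overline{a_0b_0}\,\|f_1^{-1}T_{\overline{f_2}^{-1}}v\|^{-2}f_1^{-1}T_{\overline{f_2}^{-1}}v$; then $M=\{f : f=k_0f_0,\ (k_0,0)\in K\}$ with the $S^*\oplus S^*$-invariant subspace $K=\mathbb{C}\times\{0\}$. (2) If $a_0b_0=0$, then $M=\left\{f : f=k_1\frac{f_1^{-1}T_{\overline{f_2}^{-1}}v}{\|f_1^{-1}T_{\overline{f_2}^{-1}}(S^*v)\|},\ k_1\in K\right\}$ with the $S^*$-invariant subspace $K=\mathbb{C}$.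
   Context: $H^2$ is the Hardy space of the unit disc $\mathbb{D}$, identified via boundary values with a closed subspace of $L^2(\mathbb{T})$; $H^\infty$ is the Banach algebra of bounded analytic functions on $\mathbb{D}$; $P:L^2(\mathbb{T})\to H^2$ is the orthogonal projection, $P_M$ the orthogonal projection onto $M$; the Toeplitz operator is $T_gf=P(gf)$. The backward shift is $S^*f(z)=(f(z)-f(0))/z$. $\mathbb{C}$ denotes the constant functions in $H^2$; $S^*\oplus S^*$ acts componentwise on $H^2\times H^2$. A subspace $M\subset H^2$ is nearly $S^*$-invariant with defect $m$ if there is an $m$-dimensional subspace $F$ (the defect space) such that $S^*f\in M+F$ whenever $f\in M$ and $f(0)=0$. *)

theory Defs
  imports "HOL-Analysis.Analysis" "HOL-Library.Function_Algebras"
begin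

text \<open>
  A function on the open unit disc is represented by a function on \<open>complex\<close> that
  vanishes outside the disc, so that HOL equality is equality on the disc. The zero function,
  pointwise sums and products, scalar multiples and pointwise inverses (as \<open>inverse 0 = 0\<close>)
  respect this convention; constants and the backward shift are cut off explicitly.
\<close>

abbreviation disc :: "complex set"
  where "disc \<equiv> ball 0 1"

definition disc_const :: "complex \<Rightarrow> complex \<Rightarrow> complex"
  where "disc_const c = (\<lambda>z. if z \<in> disc then c else 0)"

definition cscale :: "complex \<Rightarrow> (complex \<Rightarrow> complex) \<Rightarrow> complex \<Rightarrow> complex"
  where "cscale c f = (\<lambda>z. c * f z)"

definition cscale2 ::
    "complex \<Rightarrow> (complex \<Rightarrow> complex) \<times> (complex \<Rightarrow> complex) \<Rightarrow> (complex \<Rightarrow> complex) \<times> (complex \<Rightarrow> complex)"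
  where "cscale2 c = map_prod (cscale c) (cscale c)"

global_interpretation cfun: vector_space cscale
  by unfold_locales (auto simp: cscale_def fun_eq_iff algebra_simps)

global_interpretation cfun2: vector_space cscale2
  by unfold_locales (auto simp: cscale2_def cscale_def fun_eq_iff algebra_simps)


section \<open>The Hardy spaces\<close>

text \<open>Normalised arc length on the unit circle, as a probability measure on the plane.\<close>

definition circle :: "complex measure"
  where "circle = distr (uniform_measure lborel {-pi..pi}) borel cis"

definition L2T :: "(complex \<Rightarrow> complex) set"
  where "L2T = {h \<in> borel_measurable circle. integrable circle (\<lambda>\<zeta>. (cmod (h \<zeta>))\<^sup>2)}"

definition H2 :: "(complex \<Rightarrow> complex) set"
  where "H2 = {f. f holomorphic_on disc \<and> (\<forall>z. z \<notin> disc \<longrightarrow> f z = 0) \<and>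
    bdd_above ((\<lambda>r. \<integral>\<zeta>. (cmod (f (of_real r * \<zeta>)))\<^sup>2 \<partial>circle) ` {0..<1})}"

definition Hinf :: "(complex \<Rightarrow> complex) set"
  where "Hinf = {f. f holomorphic_on disc \<and> (\<forall>z. z \<notin> disc \<longrightarrow> f z = 0) \<and> bounded (f ` disc)}"

definition Hinf_invertible :: "(complex \<Rightarrow> complex) \<Rightarrow> bool"
  where "Hinf_invertible f \<longleftrightarrow> f \<in> Hinf \<and> (\<exists>h\<in>Hinf. f * h = disc_const 1)"

definition Hinf_inv :: "(complex \<Rightarrow> complex) \<Rightarrow> complex \<Rightarrow> complex"
  where "Hinf_inv f = (\<lambda>z. inverse (f z))"

text \<open>
  The boundary function is the limit in \<open>L\<^sup>2\<close> of the circle of the dilations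
  \<open>\<zeta> \<mapsto> f (r\<zeta>)\<close> as \<open>r\<close> increases to 1. It is determined up to null sets, and it is
  only used under integrals and in symbols of Toeplitz operators.
\<close>

definition has_boundary_function :: "(complex \<Rightarrow> complex) \<Rightarrow> (complex \<Rightarrow> complex) \<Rightarrow> bool"
  where "has_boundary_function f h \<longleftrightarrow> h \<in> L2T \<and>
    ((\<lambda>r. \<integral>\<zeta>. (cmod (f (of_real r * \<zeta>) - h \<zeta>))\<^sup>2 \<partial>circle) \<longlongrightarrow> 0) (at_left 1)"

definition bv :: "(complex \<Rightarrow> complex) \<Rightarrow> complex \<Rightarrow> complex"
  where "bv f = (SOME h. has_boundary_function f h)"

definition L2_inner :: "(complex \<Rightarrow> complex) \<Rightarrow> (complex \<Rightarrow> complex) \<Rightarrow> complex"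
  where "L2_inner h k = (\<integral>\<zeta>. h \<zeta> * cnj (k \<zeta>) \<partial>circle)"

definition H2_inner :: "(complex \<Rightarrow> complex) \<Rightarrow> (complex \<Rightarrow> complex) \<Rightarrow> complex"
  where "H2_inner f k = L2_inner (bv f) (bv k)"

definition H2_norm :: "(complex \<Rightarrow> complex) \<Rightarrow> real"
  where "H2_norm f = sqrt (\<integral>\<zeta>. (cmod (bv f \<zeta>))\<^sup>2 \<partial>circle)"

definition taylor_coeff :: "(complex \<Rightarrow> complex) \<Rightarrow> nat \<Rightarrow> complex"
  where "taylor_coeff f k = (deriv ^^ k) f 0 / fact k"


section \<open>Projections and operators\<close>

definition proj_H2 :: "(complex \<Rightarrow> complex) \<Rightarrow> complex \<Rightarrow> complex"
  where "proj_H2 h = (THE f. f \<in> H2 \<and> (\<forall>k\<in>H2. L2_inner (\<lambda>\<zeta>. h \<zeta> - bv f \<zeta>) (bv k) = 0))"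

definition proj_on :: "(complex \<Rightarrow> complex) set \<Rightarrow> (complex \<Rightarrow> complex) \<Rightarrow> complex \<Rightarrow> complex"
  where "proj_on M f = (THE h. h \<in> M \<and> (\<forall>k\<in>M. H2_inner (f - h) k = 0))"

definition toeplitz :: "(complex \<Rightarrow> complex) \<Rightarrow> (complex \<Rightarrow> complex) \<Rightarrow> complex \<Rightarrow> complex"
  where "toeplitz g f = proj_H2 (\<lambda>\<zeta>. g \<zeta> * bv f \<zeta>)"

text \<open>At the origin the difference quotient is continued by its limit \<open>f'(0)\<close>.\<close>

definition backward_shift :: "(complex \<Rightarrow> complex) \<Rightarrow> complex \<Rightarrow> complex"
  where "backward_shift f = (\<lambda>z. if z \<in> disc then (if z = 0 then deriv f 0 else (f z - f 0) / z) else 0)"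


section \<open>Invariant and nearly invariant subspaces\<close>

text \<open>Subspaces of a Hilbert space are closed by convention.\<close>

definition H2_subspace :: "(complex \<Rightarrow> complex) set \<Rightarrow> bool"
  where "H2_subspace M \<longleftrightarrow> M \<subseteq> H2 \<and> cfun.subspace M \<and>
    (\<forall>X f. (\<forall>n. X n \<in> M) \<and> f \<in> H2 \<and> (\<lambda>n. H2_norm (X n - f)) \<longlonglongrightarrow> 0 \<longrightarrow> f \<in> M)"

definition H2xH2_subspace :: "((complex \<Rightarrow> complex) \<times> (complex \<Rightarrow> complex)) set \<Rightarrow> bool"
  where "H2xH2_subspace K \<longleftrightarrow> K \<subseteq> H2 \<times> H2 \<and> cfun2.subspace K \<and>
    (\<forall>X Y f g. (\<forall>n. (X n, Y n) \<in> K) \<and> f \<in> H2 \<and> g \<in> H2 \<and>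
       (\<lambda>n. H2_norm (X n - f)) \<longlonglongrightarrow> 0 \<and> (\<lambda>n. H2_norm (Y n - g)) \<longlonglongrightarrow> 0 \<longrightarrow> (f, g) \<in> K)"

definition shift_invariant :: "(complex \<Rightarrow> complex) set \<Rightarrow> bool"
  where "shift_invariant K \<longleftrightarrow> H2_subspace K \<and> backward_shift ` K \<subseteq> K"

definition shift2_invariant :: "((complex \<Rightarrow> complex) \<times> (complex \<Rightarrow> complex)) set \<Rightarrow> bool"
  where "shift2_invariant K \<longleftrightarrow> H2xH2_subspace K \<and> map_prod backward_shift backward_shift ` K \<subseteq> K"

definition has_dim :: "(complex \<Rightarrow> complex) set \<Rightarrow> nat \<Rightarrow> bool"
  where "has_dim F m \<longleftrightarrow> (\<exists>B. finite B \<and> card B = m \<and> cfun.independent B \<and> cfun.span B = F)"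

definition defect_space :: "nat \<Rightarrow> (complex \<Rightarrow> complex) set \<Rightarrow> (complex \<Rightarrow> complex) set \<Rightarrow> bool"
  where "defect_space m M F \<longleftrightarrow> H2_subspace F \<and> has_dim F m \<and>
    (\<forall>f\<in>M. f 0 = 0 \<longrightarrow> (\<exists>h\<in>M. \<exists>k\<in>F. backward_shift f = h + k))"

definition nearly_invariant :: "nat \<Rightarrow> (complex \<Rightarrow> complex) set \<Rightarrow> bool"
  where "nearly_invariant m M \<longleftrightarrow> H2_subspace M \<and> (\<exists>F. defect_space m M F)"

end

theory Submission
  imports Defs "HOL-Complex_Analysis.Complex_Analysis"
begin

text \<open>
  Write \<open>T \<sigma>\<close> for the Toeplitz operator with symbol \<open>\<sigma>\<close>. The operator with symbol
  \<open>g = f1 * cnj f2\<close> is multiplication by \<open>f1\<close> followed by \<open>T (cnj f2)\<close>, and both factors are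
  invertible because \<open>f1\<close> and \<open>f2\<close> are. Hence \<open>T g f = x\<close> has the unique solution
  \<open>f = T s x / f1\<close> with \<open>s = 1 / cnj f2\<close> (lemma \<open>toeplitz_invertible_symbol\<close>). Applied to
  \<open>x = - <f, u> v\<close> this says that \<open>f\<close> lies in the kernel of the perturbed operator iff
  \<open>f = - <f, u> w\<close>. Since \<open><w, u> = -1\<close>, the kernel is the line spanned by \<open>w\<close>.

  An element \<open>c * w\<close> of this line vanishes at the origin only if it is zero or \<open>T s v\<close> vanishes
  there. In the second case the backward shift of \<open>w\<close> is that of \<open>T s v\<close>, divided by \<open>f1\<close>. The
  backward shift commutes with co-analytic Toeplitz operators, because both are adjoints of
  multiplications (lemma \<open>toeplitz_backward_shift\<close>); so the result is \<open>w'\<close>, and \<open>w'\<close> spans the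
  defect space. It is not zero since \<open>T g w'\<close> is the backward shift of \<open>v\<close>. The two representations
  of the line are then rescalings of its generator; in the first one the coefficient of
  the projection of the constant one is \<open>cnj (w 0)\<close> over the squared norm of \<open>w\<close>.

  The work lies in the Hardy space itself. An analytic function belongs to it iff its Taylor
  coefficients are square summable (lemma \<open>H2_iff_square_summable\<close>). Completeness of \<open>L\<^sup>2\<close> then
  provides boundary functions. They are limits almost everywhere of dilations along a sequence of
  radii (lemma \<open>dilations_converge_AE\<close>), and therefore additive and multiplicative. Orthogonal
  projections and Toeplitz operators are handled only through their inner products with Hardy
  functions (lemma \<open>toeplitz_adjoint\<close>), where all identities reduce to associativity and
  commutativity of multiplication.
\<close>

section \<open>Arc length and square-integrable functions on the circle\<close>

lemma sets_circle [simp, measurable_cong]: "sets circle = sets borel"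
  by (simp add: circle_def)

lemma space_circle [simp]: "space circle = UNIV"
  by (simp add: circle_def)

lemma borel_measurable_circle [simp]: "borel_measurable circle = borel_measurable borel"
  by (rule measurable_cong_sets) auto

lemma cis_borel [measurable]: "cis \<in> borel_measurable borel"
  by (intro borel_measurable_continuous_onI continuous_intros)

lemma cnj_borel [measurable]: "cnj \<in> borel_measurable borel"
  by (intro borel_measurable_continuous_onI continuous_intros)

lemma cis_measurable_arc: "cis \<in> measurable (uniform_measure lborel {- pi..pi}) borel"
  by (simp add: uniform_measure_def)

lemma emeasure_circle: "emeasure circle UNIV = 1"
proof -
  have "emeasure circle UNIV = emeasure (uniform_measure lborel {-pi..pi}) UNIV"
    unfolding circle_def by (subst emeasure_distr[OF cis_measurable_arc]) auto
  also have "\<dots> = emeasure lborel ({-pi..pi} \<inter> UNIV) / emeasure lborel {-pi..pi}"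
    by (rule emeasure_uniform_measure) auto
  also have "\<dots> = 1"
    by (simp add: pi_ge_zero divide_ennreal ennreal_divide_self)
  finally show ?thesis .
qed

global_interpretation circle: finite_measure circle
  by (rule finite_measureI) (simp add: emeasure_circle)

lemma measure_circle [simp]: "measure circle UNIV = 1"
  by (simp add: measure_def emeasure_circle)

lemma AE_circle_norm: "AE \<zeta> in circle. cmod \<zeta> = 1"
  unfolding circle_def by (subst AE_distr_iff[OF cis_measurable_arc]) simp_all

text \<open>
  Parametrising by \<open>cis\<close> turns the integral into one over an interval, where an antiderivative
  of the pulled-back integrand evaluates it. The factor \<open>1 / (2 * pi)\<close> normalises arc length.
\<close>

lemma integral_circle_FTC:
  assumes "continuous_on UNIV F" and "\<And>t. (G has_vector_derivative F (cis t)) (at t)"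
  shows "(\<integral>\<zeta>. F \<zeta> \<partial>circle) = (1 / (2 * pi)) *\<^sub>R (G pi - G (-pi) :: complex)"
proof -
  have F [measurable]: "F \<in> borel_measurable borel"
    by (rule borel_measurable_continuous_onI) fact
  have um: "uniform_measure lborel {- pi..pi} =
      density lborel (\<lambda>t. ennreal (indicator {-pi..pi} t / (2 * pi)))"
    unfolding uniform_measure_def
    using divide_ennreal[of 1 "2 * pi"] by (intro density_cong) (auto simp: indicator_def)
  have "(\<integral>\<zeta>. F \<zeta> \<partial>circle) = (\<integral>t. F (cis t) \<partial>uniform_measure lborel {- pi..pi})"
    unfolding circle_def by (rule integral_distr[OF cis_measurable_arc F])
  also have "\<dots> = (\<integral>t. (indicator {-pi..pi} t / (2 * pi)) *\<^sub>R F (cis t) \<partial>lborel)"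
    unfolding um by (rule integral_density) auto
  also have "\<dots> = (\<integral>t. (1 / (2 * pi)) *\<^sub>R (indicator {-pi..pi} t *\<^sub>R F (cis t)) \<partial>lborel)"
    by (rule Bochner_Integration.integral_cong) auto
  also have "\<dots> = (1 / (2 * pi)) *\<^sub>R (\<integral>t. indicator {-pi..pi} t *\<^sub>R F (cis t) \<partial>lborel)"
    by (rule integral_scaleR_right)
  also have "(\<integral>t. indicator {-pi..pi} t *\<^sub>R F (cis t) \<partial>lborel) = G pi - G (-pi)"
  proof (rule integral_FTC_Icc)
    show "continuous_on {- pi..pi} (\<lambda>t. F (cis t))"
      by (intro continuous_on_compose2[OF assms(1)] continuous_intros) auto
  qed (auto intro: has_vector_derivative_at_within assms(2))
  finally show ?thesis .
qed

lemma integral_circle_power: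
  assumes "n > 0"
  shows "(\<integral>\<zeta>. \<zeta> ^ n \<partial>circle) = 0" and "(\<integral>\<zeta>. cnj \<zeta> ^ n \<partial>circle) = 0"
proof -
  have e: "cis (-pi) = cis pi" by (simp add: complex_eq_iff)
  have eq: "(\<lambda>t. cis t ^ n / (\<i> * of_nat n)) = (\<lambda>t. exp ((\<i> * of_nat n) * of_real t) / (\<i> * of_nat n))"
    by (auto simp: cis_conv_exp fun_eq_iff exp_of_nat_mult[symmetric] mult_ac)
  have "((\<lambda>t. cis t ^ n / (\<i> * of_nat n)) has_vector_derivative cis t ^ n) (at t)" for t
    unfolding eq
    by (rule has_vector_derivative_eq_rhs, rule has_vector_derivative_real_field)
      (use assms in \<open>auto intro!: derivative_eq_intros simp: cis_conv_exp exp_of_nat_mult[symmetric] mult_ac\<close>)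
  then have "(\<integral>\<zeta>. \<zeta> ^ n \<partial>circle) = (1 / (2 * pi)) *\<^sub>R (cis pi ^ n / (\<i> * of_nat n) - cis (-pi) ^ n / (\<i> * of_nat n))"
    by (intro integral_circle_FTC continuous_intros)
  then show *: "(\<integral>\<zeta>. \<zeta> ^ n \<partial>circle) = 0" by (simp add: e)
  have "(\<integral>\<zeta>. cnj (\<zeta> ^ n) \<partial>circle) = cnj (\<integral>\<zeta>. \<zeta> ^ n \<partial>circle)"
    by (rule Bochner_Integration.integral_cnj)
  then show "(\<integral>\<zeta>. cnj \<zeta> ^ n \<partial>circle) = 0" by (simp add: *)
qed

lemma integral_circle_monomials:
  "(\<integral>\<zeta>. \<zeta> ^ n * cnj (\<zeta> ^ m) \<partial>circle) = (if n = m then 1 else 0)"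
proof -
  have unit: "\<zeta> ^ k * cnj (\<zeta> ^ k) = 1" if "cmod \<zeta> = 1" for \<zeta> k
    using complex_norm_square[of "\<zeta> ^ k"] that by (simp add: norm_power)
  have on_circle: "(\<integral>\<zeta>. \<zeta> ^ n * cnj (\<zeta> ^ m) \<partial>circle) = (\<integral>\<zeta>. F \<zeta> \<partial>circle)"
    if "\<And>\<zeta>. cmod \<zeta> = 1 \<Longrightarrow> \<zeta> ^ n * cnj (\<zeta> ^ m) = F \<zeta>" "F \<in> borel_measurable borel" for F
    by (rule integral_cong_AE) (use AE_circle_norm that in auto)
  consider "n = m" | k where "m = n + k" "k > 0" | k where "n = m + k" "k > 0"
    by (metis less_imp_add_positive nat_neq_iff)
  then show ?thesis
  proof cases
    case 1
    then show ?thesis using unit by (subst on_circle[of "\<lambda>_. 1"]) auto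
  next
    case 2
    have "\<zeta> ^ n * cnj (\<zeta> ^ m) = cnj \<zeta> ^ k" if "cmod \<zeta> = 1" for \<zeta>
      using unit[OF that, of n] by (simp add: 2 power_add mult.assoc[symmetric])
    then show ?thesis using 2 integral_circle_power(2)[OF \<open>k > 0\<close>]
      by (subst on_circle[of "\<lambda>\<zeta>. cnj \<zeta> ^ k"]) auto
  next
    case 3
    have "\<zeta> ^ n * cnj (\<zeta> ^ m) = \<zeta> ^ k" if "cmod \<zeta> = 1" for \<zeta>
      using unit[OF that, of m] by (simp add: 3 power_add mult_ac)
    then show ?thesis using 3 integral_circle_power(1)[OF \<open>k > 0\<close>]
      by (subst on_circle[of "\<lambda>\<zeta>. \<zeta> ^ k"]) auto
  qed
qed

text \<open>
  The square of the \<open>L\<^sup>2\<close> norm. Working with squares avoids roots in Parseval's formula, and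
  the parallelogram bound \<open>2 * l2sq h + 2 * l2sq k\<close> replaces the triangle inequality.
\<close>

definition l2sq :: "(complex \<Rightarrow> complex) \<Rightarrow> real"
  where "l2sq h = (\<integral>\<zeta>. (cmod (h \<zeta>))\<^sup>2 \<partial>circle)"

lemma L2T_iff: "h \<in> L2T \<longleftrightarrow> h \<in> borel_measurable borel \<and> integrable circle (\<lambda>\<zeta>. (cmod (h \<zeta>))\<^sup>2)"
  by (simp add: L2T_def)

lemma L2T_measurable [measurable_dest]: "h \<in> L2T \<Longrightarrow> h \<in> borel_measurable borel"
  by (simp add: L2T_iff)

lemma L2T_integrable: "h \<in> L2T \<Longrightarrow> integrable circle (\<lambda>\<zeta>. (cmod (h \<zeta>))\<^sup>2)"
  by (simp add: L2T_iff)

lemma norm_add_sq_le: "(norm (a + b))\<^sup>2 \<le> 2 * (norm a)\<^sup>2 + 2 * (norm b)\<^sup>2"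
  for a b :: "'a::real_normed_vector"
proof -
  have "(norm (a + b))\<^sup>2 \<le> (norm a + norm b)\<^sup>2" by (intro power_mono norm_triangle_ineq) auto
  also have "\<dots> \<le> 2 * (norm a)\<^sup>2 + 2 * (norm b)\<^sup>2"
    using sum_squares_bound[of "norm a" "norm b"] by (simp add: power2_sum)
  finally show ?thesis .
qed

lemma L2T_add: assumes "h \<in> L2T" "k \<in> L2T" shows "(\<lambda>\<zeta>. h \<zeta> + k \<zeta>) \<in> L2T"
proof -
  have [measurable]: "h \<in> borel_measurable borel" "k \<in> borel_measurable borel"
    using assms by (auto simp: L2T_iff)
  have "integrable circle (\<lambda>\<zeta>. (cmod (h \<zeta> + k \<zeta>))\<^sup>2)"
    by (rule Bochner_Integration.integrable_bound
          [where f = "\<lambda>\<zeta>. 2 * (cmod (h \<zeta>))\<^sup>2 + 2 * (cmod (k \<zeta>))\<^sup>2"])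
      (use assms in \<open>auto simp: L2T_integrable norm_add_sq_le\<close>)
  then show ?thesis by (simp add: L2T_iff)
qed

lemma L2T_scale: assumes "h \<in> L2T" shows "(\<lambda>\<zeta>. c * h \<zeta>) \<in> L2T"
  using assms by (auto simp: L2T_iff norm_mult power_mult_distrib)

lemma L2T_diff: assumes "h \<in> L2T" "k \<in> L2T" shows "(\<lambda>\<zeta>. h \<zeta> - k \<zeta>) \<in> L2T"
  using L2T_add[OF assms(1) L2T_scale[OF assms(2), of "-1"]] by simp

lemma L2T_cnj: "h \<in> L2T \<Longrightarrow> (\<lambda>\<zeta>. cnj (h \<zeta>)) \<in> L2T"
  by (auto simp: L2T_iff)

lemma L2T_bounded:
  assumes [measurable]: "h \<in> borel_measurable borel" and "AE \<zeta> in circle. cmod (h \<zeta>) \<le> B"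
  shows "h \<in> L2T"
proof -
  have "integrable circle (\<lambda>\<zeta>. (cmod (h \<zeta>))\<^sup>2)"
    by (rule circle.integrable_const_bound[where B = "B\<^sup>2"])
      (use assms in \<open>auto elim!: eventually_mono intro: power_mono\<close>)
  then show ?thesis by (simp add: L2T_iff)
qed

lemma L2T_mult_bounded:
  assumes [measurable]: "\<phi> \<in> borel_measurable borel" and B: "AE \<zeta> in circle. cmod (\<phi> \<zeta>) \<le> B"
    and h: "h \<in> L2T"
  shows "(\<lambda>\<zeta>. \<phi> \<zeta> * h \<zeta>) \<in> L2T"
proof -
  have [measurable]: "h \<in> borel_measurable borel"
    using assms by (auto simp: L2T_iff)
  have "integrable circle (\<lambda>\<zeta>. (cmod (\<phi> \<zeta> * h \<zeta>))\<^sup>2)"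
  proof (rule Bochner_Integration.integrable_bound[where f = "\<lambda>\<zeta>. B\<^sup>2 * (cmod (h \<zeta>))\<^sup>2"])
    show "AE \<zeta> in circle. norm ((cmod (\<phi> \<zeta> * h \<zeta>))\<^sup>2) \<le> norm (B\<^sup>2 * (cmod (h \<zeta>))\<^sup>2)"
      using B by eventually_elim (auto simp: norm_mult power_mult_distrib intro!: mult_right_mono power_mono)
  qed (use h in \<open>auto simp: L2T_integrable\<close>)
  then show ?thesis by (simp add: L2T_iff)
qed

lemma L2T_prod_integrable:
  assumes "h \<in> L2T" "k \<in> L2T" shows "integrable circle (\<lambda>\<zeta>. h \<zeta> * k \<zeta>)"
proof (rule Bochner_Integration.integrable_bound[where f = "\<lambda>\<zeta>. (cmod (h \<zeta>))\<^sup>2 + (cmod (k \<zeta>))\<^sup>2"])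
  have "x * y \<le> x\<^sup>2 + y\<^sup>2" if "x \<ge> 0" "y \<ge> 0" for x y :: real
    using sum_squares_bound[of x y] mult_nonneg_nonneg[OF that] by linarith
  then show "AE \<zeta> in circle. norm (h \<zeta> * k \<zeta>) \<le> norm ((cmod (h \<zeta>))\<^sup>2 + (cmod (k \<zeta>))\<^sup>2)"
    by (simp add: norm_mult)
qed (use assms in \<open>auto simp: L2T_integrable L2T_iff\<close>)

lemma L2T_inner_integrable:
  assumes "h \<in> L2T" "k \<in> L2T" shows "integrable circle (\<lambda>\<zeta>. h \<zeta> * cnj (k \<zeta>))"
  by (rule L2T_prod_integrable[OF assms(1) L2T_cnj[OF assms(2)]])

lemma L2T_const [simp]: "(\<lambda>\<zeta>. c) \<in> L2T"
  by (simp add: L2T_iff)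

lemma L2T_L1: "h \<in> L2T \<Longrightarrow> integrable circle h"
  using L2T_prod_integrable[of h "\<lambda>_. 1"] by simp

lemma l2sq_nonneg: "l2sq h \<ge> 0"
  by (simp add: l2sq_def)

lemma l2sq_scale: "l2sq (\<lambda>\<zeta>. c * h \<zeta>) = (cmod c)\<^sup>2 * l2sq h"
  by (simp add: l2sq_def norm_mult power_mult_distrib)

lemma l2sq_commute: "l2sq (\<lambda>\<zeta>. h \<zeta> - k \<zeta>) = l2sq (\<lambda>\<zeta>. k \<zeta> - h \<zeta>)"
  by (simp add: l2sq_def norm_minus_commute)

lemma l2sq_add_le:
  assumes "h \<in> L2T" "k \<in> L2T"
  shows "l2sq (\<lambda>\<zeta>. h \<zeta> + k \<zeta>) \<le> 2 * l2sq h + 2 * l2sq k"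
proof -
  have "l2sq (\<lambda>\<zeta>. h \<zeta> + k \<zeta>) \<le> (\<integral>\<zeta>. 2 * (cmod (h \<zeta>))\<^sup>2 + 2 * (cmod (k \<zeta>))\<^sup>2 \<partial>circle)"
    unfolding l2sq_def
    by (rule integral_mono)
      (use assms in \<open>auto simp: L2T_integrable norm_add_sq_le intro: L2T_integrable[OF L2T_add]\<close>)
  also have "\<dots> = 2 * l2sq h + 2 * l2sq k"
    unfolding l2sq_def using assms by (simp add: L2T_integrable)
  finally show ?thesis .
qed

lemma l2sq_triangle:
  assumes "f \<in> L2T" "h \<in> L2T" "k \<in> L2T"
  shows "l2sq (\<lambda>\<zeta>. f \<zeta> - k \<zeta>) \<le> 2 * l2sq (\<lambda>\<zeta>. f \<zeta> - h \<zeta>) + 2 * l2sq (\<lambda>\<zeta>. h \<zeta> - k \<zeta>)"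
  using l2sq_add_le[OF L2T_diff[OF assms(1,2)] L2T_diff[OF assms(2,3)]] by simp

lemma l2sq_eq_0: assumes "h \<in> L2T" "l2sq h = 0" shows "AE \<zeta> in circle. h \<zeta> = 0"
  using assms unfolding l2sq_def
  by (subst (asm) integral_nonneg_eq_0_iff_AE) (auto simp: L2T_integrable)

lemma L2_inner_cong:
  assumes "AE \<zeta> in circle. h \<zeta> = h' \<zeta>" "AE \<zeta> in circle. k \<zeta> = k' \<zeta>"
    "h \<in> borel_measurable borel" "h' \<in> borel_measurable borel"
    "k \<in> borel_measurable borel" "k' \<in> borel_measurable borel"
  shows "L2_inner h k = L2_inner h' k'"
  unfolding L2_inner_def
proof (rule integral_cong_AE)
  show "AE \<zeta> in circle. h \<zeta> * cnj (k \<zeta>) = h' \<zeta> * cnj (k' \<zeta>)"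
    using assms(1,2) by eventually_elim simp
qed (use assms(3-) in auto)

lemma L2_inner_add_left:
  "h \<in> L2T \<Longrightarrow> h' \<in> L2T \<Longrightarrow> k \<in> L2T \<Longrightarrow>
    L2_inner (\<lambda>\<zeta>. h \<zeta> + h' \<zeta>) k = L2_inner h k + L2_inner h' k"
  unfolding L2_inner_def by (simp add: distrib_right L2T_inner_integrable)

lemma L2_inner_diff_left:
  "h \<in> L2T \<Longrightarrow> h' \<in> L2T \<Longrightarrow> k \<in> L2T \<Longrightarrow>
    L2_inner (\<lambda>\<zeta>. h \<zeta> - h' \<zeta>) k = L2_inner h k - L2_inner h' k"
  unfolding L2_inner_def by (simp add: left_diff_distrib L2T_inner_integrable)

lemma L2_inner_scale_left: "L2_inner (\<lambda>\<zeta>. c * h \<zeta>) k = c * L2_inner h k"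
  unfolding L2_inner_def by (simp add: mult.assoc)

lemma L2_inner_commute: "L2_inner h k = cnj (L2_inner k h)"
  unfolding L2_inner_def by (subst Bochner_Integration.integral_cnj[symmetric]) (simp add: mult.commute)

lemma L2_inner_diff_right:
  "h \<in> L2T \<Longrightarrow> k \<in> L2T \<Longrightarrow> k' \<in> L2T \<Longrightarrow>
    L2_inner h (\<lambda>\<zeta>. k \<zeta> - k' \<zeta>) = L2_inner h k - L2_inner h k'"
  by (subst (1 2 3) L2_inner_commute) (simp add: L2_inner_diff_left)

lemma L2_inner_self: "L2_inner h h = of_real (l2sq h)"
  unfolding L2_inner_def l2sq_def
  by (simp add: complex_norm_square[symmetric] del: of_real_power)

lemma l2sq_diff:
  assumes "h \<in> L2T" "k \<in> L2T"
  shows "l2sq (\<lambda>\<zeta>. h \<zeta> - k \<zeta>) = l2sq h + l2sq k - 2 * Re (L2_inner h k)"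
proof -
  have "of_real (l2sq (\<lambda>\<zeta>. h \<zeta> - k \<zeta>)) = L2_inner h h + L2_inner k k - (L2_inner h k + L2_inner k h)"
    using assms
    by (simp add: L2_inner_self[symmetric] L2_inner_diff_left L2_inner_diff_right L2T_diff algebra_simps)
  also have "L2_inner h k + L2_inner k h = of_real (2 * Re (L2_inner h k))"
    by (subst (2) L2_inner_commute) (simp add: complex_eq_iff)
  finally have "Re (of_real (l2sq (\<lambda>\<zeta>. h \<zeta> - k \<zeta>))) =
      Re (L2_inner h h + L2_inner k k - of_real (2 * Re (L2_inner h k)))"
    by simp
  then show ?thesis by (simp add: L2_inner_self)
qed

text \<open>
  The usual discriminant argument: the quadratic polynomial
  \<open>t \<mapsto> l2sq (h - t * <h, k> * k)\<close> has no negative values.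
\<close>

lemma L2_Cauchy_Schwarz:
  assumes "h \<in> L2T" "k \<in> L2T"
  shows "(cmod (L2_inner h k))\<^sup>2 \<le> l2sq h * l2sq k"
proof -
  let ?c = "L2_inner h k"
  have *: "0 \<le> l2sq h + (t * cmod ?c)\<^sup>2 * l2sq k - 2 * t * (cmod ?c)\<^sup>2" for t :: real
  proof -
    have "L2_inner h (\<lambda>\<zeta>. of_real t * ?c * k \<zeta>) = of_real t * of_real ((cmod ?c)\<^sup>2)"
      by (subst L2_inner_commute, subst L2_inner_scale_left, subst L2_inner_commute)
        (simp add: complex_norm_square[symmetric] mult_ac del: of_real_power)
    then have "Re (L2_inner h (\<lambda>\<zeta>. of_real t * ?c * k \<zeta>)) = t * (cmod ?c)\<^sup>2"
      by simp
    then show ?thesis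
      using l2sq_diff[OF assms(1) L2T_scale[OF assms(2)], of "of_real t * ?c"]
        l2sq_nonneg[of "\<lambda>\<zeta>. h \<zeta> - of_real t * ?c * k \<zeta>"]
      by (simp add: l2sq_scale norm_mult power_mult_distrib)
  qed
  show ?thesis
  proof (cases "l2sq k = 0")
    case True
    have "(cmod ?c)\<^sup>2 = 0"
    proof (rule ccontr)
      assume ne: "(cmod ?c)\<^sup>2 \<noteq> 0"
      \<comment> \<open>The quadratic term vanishes, so a large parameter makes the polynomial negative.\<close>
      have "0 \<le> l2sq h - 2 * ((l2sq h + 1) / (cmod ?c)\<^sup>2) * (cmod ?c)\<^sup>2"
        using *[of "(l2sq h + 1) / (cmod ?c)\<^sup>2"] True by simp
      then have "0 \<le> l2sq h - 2 * (l2sq h + 1)" using ne by simp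
      then show False using l2sq_nonneg[of h] by argo
    qed
    then show ?thesis using True by simp
  next
    case False
    then have pos: "l2sq k > 0" using l2sq_nonneg[of k] by linarith
    have "0 \<le> l2sq h - (cmod ?c)\<^sup>2 / l2sq k"
      using *[of "1 / l2sq k"] False by (simp add: power_divide power2_eq_square[of "l2sq k"])
    then show ?thesis using pos by (simp add: field_simps)
  qed
qed

lemma L2_inner_tendsto_0:
  assumes "(\<lambda>n. l2sq (X n)) \<longlonglongrightarrow> 0" "\<And>n. X n \<in> L2T" "k \<in> L2T"
  shows "(\<lambda>n. L2_inner (X n) k) \<longlonglongrightarrow> 0"
proof -
  have "(\<lambda>n. (cmod (L2_inner (X n) k))\<^sup>2) \<longlonglongrightarrow> 0"
  proof (rule tendsto_sandwich[OF _ _ tendsto_const])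
    show "\<forall>\<^sub>F n in sequentially. (cmod (L2_inner (X n) k))\<^sup>2 \<le> l2sq (X n) * l2sq k"
      by (simp add: L2_Cauchy_Schwarz assms)
    show "(\<lambda>n. l2sq (X n) * l2sq k) \<longlonglongrightarrow> 0"
      using tendsto_mult_right[OF assms(1), of "l2sq k"] by simp
  qed simp
  then have "(\<lambda>n. sqrt ((cmod (L2_inner (X n) k))\<^sup>2)) \<longlonglongrightarrow> sqrt 0" by (rule tendsto_real_sqrt)
  then show ?thesis by (simp add: tendsto_norm_zero_iff)
qed

lemma L2_inner_tendsto:
  assumes "(\<lambda>n. l2sq (\<lambda>\<zeta>. X n \<zeta> - h \<zeta>)) \<longlonglongrightarrow> 0" "\<And>n. X n \<in> L2T" "h \<in> L2T" "k \<in> L2T"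
  shows "(\<lambda>n. L2_inner (X n) k) \<longlonglongrightarrow> L2_inner h k"
  using L2_inner_tendsto_0[OF assms(1) L2T_diff[OF assms(2,3)] assms(4)] assms(2-)
  by (simp add: L2_inner_diff_left LIM_zero_iff)

text \<open>
  The Riesz--Fischer argument. Along a subsequence whose consecutive \<open>L\<^sup>2\<close> distances are at most
  \<open>(1/2)^k\<close> the increments are summable almost everywhere, so the subsequence has a pointwise limit;
  Fatou's lemma then turns the Cauchy estimate into a bound on the distance to that limit.
  The Cauchy condition comes with an explicit rate because it is the tail of a series in the
  application.
\<close>

lemma L2_complete:
  assumes X: "\<And>n. X n \<in> L2T" and e: "e \<longlonglongrightarrow> 0"
    and cauchy: "\<And>m n. n \<le> m \<Longrightarrow> l2sq (\<lambda>\<zeta>. X m \<zeta> - X n \<zeta>) \<le> e n"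
  shows "\<exists>h\<in>L2T. (\<lambda>n. l2sq (\<lambda>\<zeta>. X n \<zeta> - h \<zeta>)) \<longlonglongrightarrow> 0"
proof -
  have [measurable]: "X n \<in> borel_measurable borel" for n using X L2T_iff by blast
  have "\<exists>N. \<forall>n\<ge>N. e n < (1/4)^k" for k
    using order_tendstoD(2)[OF e, of "(1/4)^k"] by (simp add: eventually_sequentially)
  then obtain N where N: "\<And>k n. n \<ge> N k \<Longrightarrow> e n < (1/4)^k" by metis
  \<comment> \<open>Summing the \<open>N i\<close> makes the index sequence monotone, adding \<open>k\<close> makes it unbounded.\<close>
  define r where "r k = (\<Sum>i\<le>k. N i) + k" for k
  have r_Suc: "r k \<le> r (Suc k)" and r_ge: "r k \<ge> N k" and rk: "r k \<ge> k" for k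
    by (auto simp: r_def intro: trans_le_add1 member_le_sum)
  have r_top: "filterlim r at_top sequentially"
    by (rule filterlim_at_top_mono[OF filterlim_ident]) (simp add: rk)
  define Y where "Y k = X (r k)" for k
  have Y: "Y k \<in> L2T" for k by (simp add: Y_def X)
  have [measurable]: "Y k \<in> borel_measurable borel" for k by (simp add: Y_def)
  define d where "d k = (\<lambda>\<zeta>. Y (Suc k) \<zeta> - Y k \<zeta>)" for k
  have d: "d k \<in> L2T" for k unfolding d_def by (intro L2T_diff Y)
  have [measurable]: "d k \<in> borel_measurable borel" for k using d L2T_iff by blast
  \<comment> \<open>The measure has total mass one, so the \<open>L\<^sup>1\<close> norm is at most the \<open>L\<^sup>2\<close> norm.\<close>
  have d_le: "(\<integral>\<zeta>. cmod (d k \<zeta>) \<partial>circle) \<le> (1/2)^k" for k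
  proof -
    have nd: "(\<lambda>\<zeta>. of_real (cmod (d k \<zeta>)) :: complex) \<in> L2T"
      using d[of k] by (auto simp: L2T_iff)
    have "L2_inner (\<lambda>\<zeta>. of_real (cmod (d k \<zeta>))) (\<lambda>_. 1) = of_real (\<integral>\<zeta>. cmod (d k \<zeta>) \<partial>circle)"
      by (simp add: L2_inner_def)
    then have "(\<integral>\<zeta>. cmod (d k \<zeta>) \<partial>circle)\<^sup>2 \<le> l2sq (\<lambda>\<zeta>. of_real (cmod (d k \<zeta>))) * l2sq (\<lambda>_. 1)"
      using L2_Cauchy_Schwarz[OF nd L2T_const[of 1]] by simp
    also have "\<dots> = l2sq (d k)" by (simp add: l2sq_def)
    also have "\<dots> \<le> e (r k)"
      unfolding d_def Y_def by (rule cauchy) (rule r_Suc)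
    also have "\<dots> \<le> (1/4)^k" using N[OF r_ge, of k] by simp
    also have "\<dots> = ((1/2)^k)\<^sup>2" by (simp add: power2_eq_square power_mult_distrib[symmetric])
    finally show ?thesis by (rule power2_le_imp_le) simp
  qed
  have AE_conv: "AE \<zeta> in circle. convergent (\<lambda>k. Y k \<zeta>)"
  proof -
    have "(\<integral>\<^sup>+\<zeta>. (\<Sum>k. ennreal (cmod (d k \<zeta>))) \<partial>circle) = (\<Sum>k. \<integral>\<^sup>+\<zeta>. ennreal (cmod (d k \<zeta>)) \<partial>circle)"
      by (rule nn_integral_suminf) simp
    also have "\<dots> \<le> (\<Sum>k. ennreal ((1/2)^k))"
    proof (rule suminf_le)
      fix k
      have "(\<integral>\<^sup>+\<zeta>. ennreal (cmod (d k \<zeta>)) \<partial>circle) = ennreal (\<integral>\<zeta>. cmod (d k \<zeta>) \<partial>circle)"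
        by (rule nn_integral_eq_integral) (auto intro: L2T_L1 d)
      also have "\<dots> \<le> ennreal ((1/2)^k)" by (rule ennreal_leI) (rule d_le)
      finally show "(\<integral>\<^sup>+\<zeta>. ennreal (cmod (d k \<zeta>)) \<partial>circle) \<le> ennreal ((1/2)^k)" .
    qed auto
    also have "\<dots> = ennreal (\<Sum>k. (1/2)^k)"
      by (rule suminf_ennreal2) auto
    also have "\<dots> < \<infinity>" by simp
    finally have "AE \<zeta> in circle. (\<Sum>k. ennreal (cmod (d k \<zeta>))) \<noteq> \<infinity>"
      by (intro nn_integral_PInf_AE) auto
    then show ?thesis
    proof eventually_elim
      case (elim \<zeta>)
      then have "summable (\<lambda>k. cmod (d k \<zeta>))"
        by (intro summable_suminf_not_top) auto
      then have "summable (\<lambda>k. d k \<zeta>)" by (rule summable_norm_cancel)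
      then have "convergent (\<lambda>n. \<Sum>k<n. d k \<zeta>)" by (simp add: summable_iff_convergent)
      moreover have "(\<Sum>k<n. d k \<zeta>) = Y n \<zeta> - Y 0 \<zeta>" for n
        unfolding d_def by (rule sum_lessThan_telescope)
      ultimately have "convergent (\<lambda>n. (Y n \<zeta> - Y 0 \<zeta>) + Y 0 \<zeta>)"
        by (intro convergent_add convergent_const) simp
      then show ?case by simp
    qed
  qed
  define h where "h = (\<lambda>\<zeta>. lim (\<lambda>k. Y k \<zeta>))"
  have [measurable]: "h \<in> borel_measurable borel" unfolding h_def by measurable
  have Yh: "AE \<zeta> in circle. (\<lambda>k. Y k \<zeta>) \<longlonglongrightarrow> h \<zeta>"
    using AE_conv by eventually_elim (simp add: h_def convergent_LIMSEQ_iff)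
  have fatou: "(\<integral>\<^sup>+\<zeta>. ennreal ((cmod (X n \<zeta> - h \<zeta>))\<^sup>2) \<partial>circle) \<le> ennreal (e n)" for n
  proof -
    have "(\<integral>\<^sup>+\<zeta>. ennreal ((cmod (X n \<zeta> - h \<zeta>))\<^sup>2) \<partial>circle) =
        (\<integral>\<^sup>+\<zeta>. liminf (\<lambda>k. ennreal ((cmod (X n \<zeta> - Y k \<zeta>))\<^sup>2)) \<partial>circle)"
    proof (rule nn_integral_cong_AE)
      show "AE \<zeta> in circle. ennreal ((cmod (X n \<zeta> - h \<zeta>))\<^sup>2) = liminf (\<lambda>k. ennreal ((cmod (X n \<zeta> - Y k \<zeta>))\<^sup>2))"
        using Yh
      proof eventually_elim
        case (elim \<zeta>)
        have "(\<lambda>k. ennreal ((cmod (X n \<zeta> - Y k \<zeta>))\<^sup>2)) \<longlonglongrightarrow> ennreal ((cmod (X n \<zeta> - h \<zeta>))\<^sup>2)"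
          by (intro tendsto_intros tendsto_ennrealI elim)
        from lim_imp_Liminf[OF _ this] show ?case by simp
      qed
    qed
    also have "\<dots> \<le> liminf (\<lambda>k. \<integral>\<^sup>+\<zeta>. ennreal ((cmod (X n \<zeta> - Y k \<zeta>))\<^sup>2) \<partial>circle)"
      by (rule nn_integral_liminf) simp
    also have "\<dots> \<le> liminf (\<lambda>k. ennreal (e n))"
    proof (rule Liminf_mono)
      have "(\<integral>\<^sup>+\<zeta>. ennreal ((cmod (X n \<zeta> - Y k \<zeta>))\<^sup>2) \<partial>circle) \<le> ennreal (e n)" if "r k \<ge> n" for k
      proof -
        have "(\<integral>\<^sup>+\<zeta>. ennreal ((cmod (X n \<zeta> - Y k \<zeta>))\<^sup>2) \<partial>circle) = ennreal (l2sq (\<lambda>\<zeta>. X n \<zeta> - Y k \<zeta>))"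
          unfolding l2sq_def by (rule nn_integral_eq_integral[OF L2T_integrable[OF L2T_diff[OF X Y]]]) simp
        also have "l2sq (\<lambda>\<zeta>. X n \<zeta> - Y k \<zeta>) \<le> e n"
          using cauchy[OF that] by (simp add: l2sq_commute Y_def)
        finally show ?thesis by (simp add: ennreal_leI)
      qed
      moreover have "\<forall>\<^sub>F k in sequentially. r k \<ge> n" using r_top by (simp add: filterlim_at_top)
      ultimately show "\<forall>\<^sub>F k in sequentially. (\<integral>\<^sup>+\<zeta>. ennreal ((cmod (X n \<zeta> - Y k \<zeta>))\<^sup>2) \<partial>circle) \<le> ennreal (e n)"
        by (auto elim: eventually_mono)
    qed
    also have "\<dots> = ennreal (e n)" by (simp add: Liminf_const)
    finally show ?thesis .
  qed
  have Xh: "(\<lambda>\<zeta>. X n \<zeta> - h \<zeta>) \<in> L2T" for n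
    unfolding L2T_iff
  proof (intro conjI integrableI_bounded)
    show "(\<integral>\<^sup>+\<zeta>. ennreal (norm ((cmod (X n \<zeta> - h \<zeta>))\<^sup>2)) \<partial>circle) < \<infinity>"
      using fatou[of n] by (auto intro: le_less_trans)
  qed auto
  have "h \<in> L2T" using L2T_diff[OF X[of 0] Xh[of 0]] by simp
  moreover have "(\<lambda>n. l2sq (\<lambda>\<zeta>. X n \<zeta> - h \<zeta>)) \<longlonglongrightarrow> 0"
  proof (rule tendsto_sandwich[OF _ _ tendsto_const e])
    have "e n \<ge> 0" for n using cauchy[of n n] l2sq_nonneg order_trans by blast
    moreover have "ennreal (l2sq (\<lambda>\<zeta>. X n \<zeta> - h \<zeta>)) \<le> ennreal (e n)" for n
      using fatou[of n] L2T_integrable[OF Xh] unfolding l2sq_def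
      by (subst nn_integral_eq_integral[symmetric]) auto
    ultimately show "\<forall>\<^sub>F n in sequentially. l2sq (\<lambda>\<zeta>. X n \<zeta> - h \<zeta>) \<le> e n"
      by simp
  qed (simp add: l2sq_nonneg)
  ultimately show ?thesis by blast
qed

section \<open>Analytic Fourier series\<close>

definition fourier_sum :: "(nat \<Rightarrow> complex) \<Rightarrow> nat \<Rightarrow> complex \<Rightarrow> complex"
  where "fourier_sum c N = (\<lambda>\<zeta>. \<Sum>n<N. c n * \<zeta> ^ n)"

text \<open>
  The function \<open>h\<close> is the sum in \<open>L\<^sup>2\<close> of the series with coefficients \<open>c n\<close> at
  \<open>\<zeta>^n\<close>. Since only nonnegative frequencies occur, these are exactly the functions that can be
  boundary functions of elements of the Hardy space.
\<close>

definition l2_series :: "(complex \<Rightarrow> complex) \<Rightarrow> (nat \<Rightarrow> complex) \<Rightarrow> bool"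
  where "l2_series h c \<longleftrightarrow> h \<in> L2T \<and> (\<lambda>N. l2sq (\<lambda>\<zeta>. fourier_sum c N \<zeta> - h \<zeta>)) \<longlonglongrightarrow> 0"

lemma L2T_monomial [simp]: "(\<lambda>\<zeta>. \<zeta> ^ n) \<in> L2T"
proof (rule L2T_bounded)
  show "AE \<zeta> in circle. cmod (\<zeta> ^ n) \<le> 1"
    using AE_circle_norm by eventually_elim (simp add: norm_power)
qed simp

lemma fourier_sum_Suc: "fourier_sum c (Suc N) = (\<lambda>\<zeta>. fourier_sum c N \<zeta> + c N * \<zeta> ^ N)"
  by (simp add: fourier_sum_def)

lemma L2T_fourier_sum [simp]: "fourier_sum c N \<in> L2T"
proof (induction N)
  case 0
  show ?case by (simp add: fourier_sum_def)
next
  case (Suc N)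
  then show ?case unfolding fourier_sum_Suc by (intro L2T_add L2T_scale) simp_all
qed

lemma L2_inner_monomials: "L2_inner (\<lambda>\<zeta>. \<zeta> ^ n) (\<lambda>\<zeta>. \<zeta> ^ m) = (if n = m then 1 else 0)"
  unfolding L2_inner_def by (rule integral_circle_monomials)

lemma L2_inner_fourier_sum:
  assumes "k \<in> L2T"
  shows "L2_inner (fourier_sum c N) k = (\<Sum>n<N. c n * L2_inner (\<lambda>\<zeta>. \<zeta> ^ n) k)"
proof (induction N)
  case 0
  show ?case by (simp add: fourier_sum_def L2_inner_def)
next
  case (Suc N)
  then show ?case unfolding fourier_sum_Suc
    by (simp add: L2_inner_add_left L2T_scale assms L2_inner_scale_left)
qed

lemma L2_inner_fourier_sum_monomial:
  "L2_inner (fourier_sum c N) (\<lambda>\<zeta>. \<zeta> ^ m) = (if m < N then c m else 0)"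
  by (simp add: L2_inner_fourier_sum L2_inner_monomials if_distrib cong: if_cong)

lemma l2sq_fourier_sum: "l2sq (fourier_sum c N) = (\<Sum>n<N. (cmod (c n))\<^sup>2)"
proof -
  have "complex_of_real (l2sq (fourier_sum c N)) = (\<Sum>n<N. c n * cnj (c n))"
    unfolding L2_inner_self[symmetric] L2_inner_fourier_sum[OF L2T_fourier_sum]
    by (subst L2_inner_commute) (simp add: L2_inner_fourier_sum_monomial)
  also have "\<dots> = complex_of_real (\<Sum>n<N. (cmod (c n))\<^sup>2)"
    by (simp add: complex_norm_square del: of_real_power)
  finally show ?thesis by (simp only: of_real_eq_iff)
qed

text \<open>
  The partial Fourier sum is the orthogonal projection onto polynomials of degree less than \<open>N\<close>, so
  Pythagoras applies. This gives Bessel's inequality for every \<open>h\<close>, and Parseval's formula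
  whenever the left side tends to zero.
\<close>

lemma Bessel_identity:
  assumes "h \<in> L2T" and c: "\<And>n. L2_inner h (\<lambda>\<zeta>. \<zeta> ^ n) = c n"
  shows "l2sq (\<lambda>\<zeta>. fourier_sum c N \<zeta> - h \<zeta>) = l2sq h - (\<Sum>n<N. (cmod (c n))\<^sup>2)"
proof -
  have "L2_inner (fourier_sum c N) h = (\<Sum>n<N. c n * cnj (c n))"
    unfolding L2_inner_fourier_sum[OF assms(1)] by (subst L2_inner_commute) (simp add: c)
  also have "\<dots> = complex_of_real (\<Sum>n<N. (cmod (c n))\<^sup>2)"
    by (simp add: complex_norm_square del: of_real_power)
  finally have "Re (L2_inner (fourier_sum c N) h) = (\<Sum>n<N. (cmod (c n))\<^sup>2)"
    by (simp only: Re_complex_of_real)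
  then show ?thesis
    using l2sq_diff[OF L2T_fourier_sum assms(1), of c N] by (simp add: l2sq_fourier_sum)
qed

lemma l2_seriesD: "l2_series h c \<Longrightarrow> h \<in> L2T"
  by (simp add: l2_series_def)

lemma l2_series_coeff:
  assumes "l2_series h c"
  shows "L2_inner h (\<lambda>\<zeta>. \<zeta> ^ m) = c m"
proof (rule LIMSEQ_unique)
  show "(\<lambda>N. L2_inner (fourier_sum c N) (\<lambda>\<zeta>. \<zeta> ^ m)) \<longlonglongrightarrow> L2_inner h (\<lambda>\<zeta>. \<zeta> ^ m)"
    by (rule L2_inner_tendsto) (use assms in \<open>auto simp: l2_series_def\<close>)
  have "\<forall>\<^sub>F N in sequentially. L2_inner (fourier_sum c N) (\<lambda>\<zeta>. \<zeta> ^ m) = c m"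
    using eventually_gt_at_top[of m] by eventually_elim (simp add: L2_inner_fourier_sum_monomial)
  then show "(\<lambda>N. L2_inner (fourier_sum c N) (\<lambda>\<zeta>. \<zeta> ^ m)) \<longlonglongrightarrow> c m"
    by (rule tendsto_eventually)
qed

lemma l2_series_Parseval:
  assumes "l2_series h c"
  shows "(\<lambda>n. (cmod (c n))\<^sup>2) sums l2sq h"
proof -
  have "(\<lambda>N. l2sq h - l2sq (\<lambda>\<zeta>. fourier_sum c N \<zeta> - h \<zeta>)) \<longlonglongrightarrow> l2sq h - 0"
    by (intro tendsto_diff tendsto_const) (use assms in \<open>simp add: l2_series_def\<close>)
  moreover have "l2sq h - l2sq (\<lambda>\<zeta>. fourier_sum c N \<zeta> - h \<zeta>) = (\<Sum>n<N. (cmod (c n))\<^sup>2)" for N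
    by (subst Bessel_identity[OF l2_seriesD[OF assms] l2_series_coeff[OF assms]]) simp
  ultimately show ?thesis by (simp add: sums_def)
qed

lemma l2_series_diff:
  assumes h: "l2_series h c" and k: "l2_series k d"
  shows "l2_series (\<lambda>\<zeta>. h \<zeta> - k \<zeta>) (\<lambda>n. c n - d n)"
proof -
  have hk: "h \<in> L2T" "k \<in> L2T" using assms by (auto simp: l2_series_def)
  have eq: "(\<lambda>\<zeta>. fourier_sum (\<lambda>n. c n - d n) N \<zeta> - (h \<zeta> - k \<zeta>)) =
      (\<lambda>\<zeta>. (fourier_sum c N \<zeta> - h \<zeta>) - (fourier_sum d N \<zeta> - k \<zeta>))" for N
    by (simp add: fourier_sum_def sum_subtractf left_diff_distrib algebra_simps fun_eq_iff)
  have "l2sq (\<lambda>\<zeta>. fourier_sum (\<lambda>n. c n - d n) N \<zeta> - (h \<zeta> - k \<zeta>)) \<le>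
      2 * l2sq (\<lambda>\<zeta>. fourier_sum c N \<zeta> - h \<zeta>) + 2 * l2sq (\<lambda>\<zeta>. fourier_sum d N \<zeta> - k \<zeta>)" for N
    using l2sq_triangle[of "\<lambda>\<zeta>. fourier_sum c N \<zeta> - h \<zeta>" "\<lambda>_. 0" "\<lambda>\<zeta>. fourier_sum d N \<zeta> - k \<zeta>"]
      hk l2sq_scale[of "-1" "\<lambda>\<zeta>. fourier_sum d N \<zeta> - k \<zeta>"]
    unfolding eq by (simp add: L2T_diff)
  then have le: "\<forall>\<^sub>F N in sequentially. l2sq (\<lambda>\<zeta>. fourier_sum (\<lambda>n. c n - d n) N \<zeta> - (h \<zeta> - k \<zeta>)) \<le>
      2 * l2sq (\<lambda>\<zeta>. fourier_sum c N \<zeta> - h \<zeta>) + 2 * l2sq (\<lambda>\<zeta>. fourier_sum d N \<zeta> - k \<zeta>)"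
    by (intro always_eventually allI)
  have "(\<lambda>N. l2sq (\<lambda>\<zeta>. fourier_sum c N \<zeta> - h \<zeta>)) \<longlonglongrightarrow> 0"
    "(\<lambda>N. l2sq (\<lambda>\<zeta>. fourier_sum d N \<zeta> - k \<zeta>)) \<longlonglongrightarrow> 0"
    using assms by (simp_all add: l2_series_def)
  then have "(\<lambda>N. 2 * l2sq (\<lambda>\<zeta>. fourier_sum c N \<zeta> - h \<zeta>) + 2 * l2sq (\<lambda>\<zeta>. fourier_sum d N \<zeta> - k \<zeta>))
      \<longlonglongrightarrow> 2 * 0 + 2 * 0"
    by (intro tendsto_intros)
  then have "(\<lambda>N. l2sq (\<lambda>\<zeta>. fourier_sum (\<lambda>n. c n - d n) N \<zeta> - (h \<zeta> - k \<zeta>))) \<longlonglongrightarrow> 0"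
    by (intro tendsto_sandwich[OF _ le tendsto_const]) (simp_all add: l2sq_nonneg)
  then show ?thesis by (simp add: l2_series_def L2T_diff hk)
qed

lemma sum_lessThan_diff:
  fixes F :: "nat \<Rightarrow> 'a::ab_group_add"
  assumes "N \<le> m"
  shows "(\<Sum>n<m. F n) - (\<Sum>n<N. F n) = (\<Sum>n<m. if n < N then 0 else F n)"
proof -
  have "(\<Sum>n<m. F n) - (\<Sum>n<N. F n) = sum F ({..<m} - {..<N})"
    using assms by (intro sum_diff[symmetric]) auto
  also have "\<dots> = (\<Sum>n<m. if n < N then 0 else F n)"
    by (intro sum.mono_neutral_cong_left) auto
  finally show ?thesis .
qed

text \<open>
  The squared distance of two partial sums is a block of the series of squares, hence at most a tail
  of that series.
\<close>

lemma Riesz_Fischer: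
  assumes "summable (\<lambda>n. (cmod (c n))\<^sup>2)"
  shows "\<exists>h. l2_series h c"
proof -
  let ?S = "\<lambda>N. \<Sum>n<N. (cmod (c n))\<^sup>2"
  let ?e = "\<lambda>N. (\<Sum>n. (cmod (c n))\<^sup>2) - ?S N"
  have "\<exists>h\<in>L2T. (\<lambda>N. l2sq (\<lambda>\<zeta>. fourier_sum c N \<zeta> - h \<zeta>)) \<longlonglongrightarrow> 0"
  proof (rule L2_complete)
    show "?e \<longlonglongrightarrow> 0"
      using tendsto_diff[OF tendsto_const summable_LIMSEQ[OF assms], of "\<Sum>n. (cmod (c n))\<^sup>2"] by simp
    fix m N :: nat assume "N \<le> m"
    have "(\<lambda>\<zeta>. fourier_sum c m \<zeta> - fourier_sum c N \<zeta>) = fourier_sum (\<lambda>n. if n < N then 0 else c n) m"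
      unfolding fourier_sum_def sum_lessThan_diff[OF \<open>N \<le> m\<close>]
      by (intro ext sum.cong) auto
    then have "l2sq (\<lambda>\<zeta>. fourier_sum c m \<zeta> - fourier_sum c N \<zeta>) = (\<Sum>n<m. (cmod (if n < N then 0 else c n))\<^sup>2)"
      by (simp add: l2sq_fourier_sum)
    also have "\<dots> = ?S m - ?S N"
      unfolding sum_lessThan_diff[OF \<open>N \<le> m\<close>] by (intro sum.cong) auto
    also have "\<dots> \<le> ?e N"
      using sum_le_suminf[OF assms, of "{..<m}"] by simp
    finally show "l2sq (\<lambda>\<zeta>. fourier_sum c m \<zeta> - fourier_sum c N \<zeta>) \<le> ?e N" .
  qed simp
  then show ?thesis by (auto simp: l2_series_def)
qed

section \<open>Hardy functions as square-summable power series\<close>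

text \<open>
  Inside the disc the power series converges uniformly on each circle, a fortiori in \<open>L\<^sup>2\<close>. The
  coefficients are an arbitrary expansion of \<open>f\<close>, so that this lemma can also show that expansions
  are unique.
\<close>

lemma l2_series_dilation:
  assumes [measurable]: "f \<in> borel_measurable borel"
    and f: "\<And>z. z \<in> disc \<Longrightarrow> (\<lambda>n. c n * z ^ n) sums f z" and r: "0 \<le> r" "r < 1"
  shows "l2_series (\<lambda>\<zeta>. f (of_real r * \<zeta>)) (\<lambda>n. c n * of_real r ^ n)"
proof -
  obtain R where R: "r < R" "R < 1" using dense[OF r(2)] by blast
  have "summable (\<lambda>n. c n * of_real R ^ n)"
    using f[of "of_real R"] R r by (intro sums_summable) auto
  then have "summable (\<lambda>n. norm (c n * of_real r ^ n))"
    by (rule powser_insidea) (use R r in auto)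
  then have sm: "summable (\<lambda>n. cmod (c n) * r ^ n)" using r by (simp add: norm_mult norm_power)
  let ?t = "\<lambda>N. (\<Sum>n. cmod (c (n + N)) * r ^ (n + N))"
  have t: "?t \<longlonglongrightarrow> 0"
    using tendsto_diff[OF tendsto_const summable_LIMSEQ[OF sm], of "\<Sum>n. cmod (c n) * r ^ n"]
    by (subst suminf_minus_initial_segment[OF sm]) simp
  have bound: "cmod (fourier_sum (\<lambda>n. c n * of_real r ^ n) N \<zeta> - f (of_real r * \<zeta>)) \<le> ?t N"
    if "cmod \<zeta> = 1" for \<zeta> N
  proof -
    have fs: "(\<lambda>n. c n * (of_real r * \<zeta>) ^ n) sums f (of_real r * \<zeta>)"
      using that r by (intro f) (simp add: norm_mult)
    have "f (of_real r * \<zeta>) - fourier_sum (\<lambda>n. c n * of_real r ^ n) N \<zeta> =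
        (\<Sum>n. c (n + N) * (of_real r * \<zeta>) ^ (n + N))"
      using suminf_minus_initial_segment[OF sums_summable[OF fs], of N] sums_unique[OF fs]
      by (simp add: fourier_sum_def power_mult_distrib mult_ac)
    also have "cmod \<dots> \<le> (\<Sum>n. cmod (c (n + N) * (of_real r * \<zeta>) ^ (n + N)))"
      using summable_ignore_initial_segment[OF sm, of N] that r
      by (intro summable_norm) (simp add: norm_mult norm_power)
    also have "\<dots> = ?t N" using that r by (simp add: norm_mult norm_power)
    finally show ?thesis by (simp add: norm_minus_commute)
  qed
  have "AE \<zeta> in circle. cmod (fourier_sum (\<lambda>n. c n * of_real r ^ n) 0 \<zeta> - f (of_real r * \<zeta>)) \<le> ?t 0"
    using AE_circle_norm by eventually_elim (rule bound)
  then have "AE \<zeta> in circle. cmod (f (of_real r * \<zeta>)) \<le> ?t 0"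
    by (simp add: fourier_sum_def)
  then have fr: "(\<lambda>\<zeta>. f (of_real r * \<zeta>)) \<in> L2T"
    by (intro L2T_bounded[where B = "?t 0"]) auto
  have le: "l2sq (\<lambda>\<zeta>. fourier_sum (\<lambda>n. c n * of_real r ^ n) N \<zeta> - f (of_real r * \<zeta>)) \<le> (?t N)\<^sup>2" for N
  proof -
    have "l2sq (\<lambda>\<zeta>. fourier_sum (\<lambda>n. c n * of_real r ^ n) N \<zeta> - f (of_real r * \<zeta>)) \<le> (\<integral>\<zeta>. (?t N)\<^sup>2 \<partial>circle)"
      unfolding l2sq_def
    proof (rule integral_mono_AE)
      show "AE \<zeta> in circle. (cmod (fourier_sum (\<lambda>n. c n * of_real r ^ n) N \<zeta> - f (of_real r * \<zeta>)))\<^sup>2 \<le> (?t N)\<^sup>2"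
        using AE_circle_norm by eventually_elim (intro power_mono bound, auto)
    qed (auto intro!: L2T_integrable[OF L2T_diff[OF L2T_fourier_sum fr]])
    then show ?thesis by simp
  qed
  have "(\<lambda>N. l2sq (\<lambda>\<zeta>. fourier_sum (\<lambda>n. c n * of_real r ^ n) N \<zeta> - f (of_real r * \<zeta>))) \<longlonglongrightarrow> 0"
    by (rule tendsto_sandwich[OF _ _ tendsto_const, where h = "\<lambda>N. (?t N)\<^sup>2"])
      (use le tendsto_power[OF t, of 2] in \<open>auto simp: l2sq_nonneg\<close>)
  then show ?thesis by (simp add: l2_series_def fr)
qed

lemma borel_measurable_disc_function:
  assumes "f holomorphic_on disc" "\<And>z. z \<notin> disc \<Longrightarrow> f z = 0"
  shows "f \<in> borel_measurable borel"
proof -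
  have "(\<lambda>z. indicator disc z *\<^sub>R f z) \<in> borel_measurable borel"
    by (rule borel_measurable_continuous_on_indicator)
      (auto intro: holomorphic_on_imp_continuous_on assms)
  also have "(\<lambda>z. indicator disc z *\<^sub>R f z) = f"
    using assms(2) by (auto simp: fun_eq_iff indicator_def)
  finally show ?thesis .
qed

lemma Taylor_sums:
  assumes "f holomorphic_on disc" "z \<in> disc"
  shows "(\<lambda>n. taylor_coeff f n * z ^ n) sums f z"
  using holomorphic_power_series[OF assms] by (simp add: taylor_coeff_def)

lemma l2_series_dilation_Taylor:
  assumes "f holomorphic_on disc" "\<And>z. z \<notin> disc \<Longrightarrow> f z = 0" "0 \<le> r" "r < 1"
  shows "l2_series (\<lambda>\<zeta>. f (of_real r * \<zeta>)) (\<lambda>n. taylor_coeff f n * of_real r ^ n)"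
  by (rule l2_series_dilation) (use assms in \<open>auto intro: Taylor_sums borel_measurable_disc_function\<close>)

lemma l2sq_dilation:
  assumes "f holomorphic_on disc" "\<And>z. z \<notin> disc \<Longrightarrow> f z = 0" "0 \<le> r" "r < 1"
  shows "(\<lambda>n. (cmod (taylor_coeff f n))\<^sup>2 * (r ^ n)\<^sup>2) sums l2sq (\<lambda>\<zeta>. f (of_real r * \<zeta>))"
  using l2_series_Parseval[OF l2_series_dilation_Taylor[OF assms]] \<open>0 \<le> r\<close>
  by (simp add: norm_mult norm_power power_mult_distrib)

text \<open>
  By Parseval, the integral mean of order two at radius \<open>r\<close> is the sum of
  \<open>|a n|^2 * r^(2 * n)\<close>. It increases with \<open>r\<close>, and it is bounded exactly when the series
  at \<open>r = 1\<close> converges.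
\<close>

theorem H2_iff_square_summable:
  "f \<in> H2 \<longleftrightarrow> f holomorphic_on disc \<and> (\<forall>z. z \<notin> disc \<longrightarrow> f z = 0) \<and>
    summable (\<lambda>n. (cmod (taylor_coeff f n))\<^sup>2)"
proof (cases "f holomorphic_on disc \<and> (\<forall>z. z \<notin> disc \<longrightarrow> f z = 0)")
  case True
  then have hol: "f holomorphic_on disc" and zero: "\<And>z. z \<notin> disc \<Longrightarrow> f z = 0" by auto
  let ?a = "\<lambda>n. (cmod (taylor_coeff f n))\<^sup>2"
  let ?I = "\<lambda>r. l2sq (\<lambda>\<zeta>. f (of_real r * \<zeta>))"
  have "bdd_above (?I ` {0..<1}) \<longleftrightarrow> summable ?a"
  proof
    assume "bdd_above (?I ` {0..<1})"
    then obtain C where "\<forall>x\<in>?I ` {0..<1}. x \<le> C" unfolding bdd_above_def by blast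
    then have C: "?I r \<le> C" if "0 \<le> r" "r < 1" for r using that by auto
    have "(\<Sum>n<N. ?a n) \<le> C" for N
    proof (rule tendsto_upperbound)
      show "((\<lambda>r. \<Sum>n<N. ?a n * (r ^ n)\<^sup>2) \<longlongrightarrow> (\<Sum>n<N. ?a n)) (at_left 1)"
        by (auto intro!: tendsto_eq_intros)
      show "\<forall>\<^sub>F r in at_left 1. (\<Sum>n<N. ?a n * (r ^ n)\<^sup>2) \<le> C"
        using eventually_at_left_real[of 0 1, simplified]
      proof eventually_elim
        case (elim r)
        then have r: "0 \<le> r" "r < 1" by auto
        have "(\<Sum>n<N. ?a n * (r ^ n)\<^sup>2) \<le> ?I r"
          using sum_le_suminf[OF sums_summable[OF l2sq_dilation[OF hol zero r]], of "{..<N}"]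
            sums_unique[OF l2sq_dilation[OF hol zero r]] by simp
        then show ?case using C[OF r] by linarith
      qed
    qed simp
    then show "summable ?a"
      by (intro summableI_nonneg_bounded) auto
  next
    assume sm: "summable ?a"
    have "?I r \<le> suminf ?a" if "0 \<le> r" "r < 1" for r
    proof (rule sums_le[OF _ l2sq_dilation[OF hol zero that] summable_sums[OF sm]])
      show "?a n * (r ^ n)\<^sup>2 \<le> ?a n" for n
        using that by (intro mult_left_le) (auto simp: power_le_one)
    qed
    then show "bdd_above (?I ` {0..<1})" by (intro bdd_aboveI[of _ "suminf ?a"]) auto
  qed
  then show ?thesis using True by (simp add: H2_def l2sq_def)
next
  case False
  then show ?thesis by (auto simp: H2_def)
qed

lemma H2D:
  assumes "f \<in> H2"
  shows "f holomorphic_on disc" "z \<notin> disc \<Longrightarrow> f z = 0" "summable (\<lambda>n. (cmod (taylor_coeff f n))\<^sup>2)"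
  using assms by (auto simp: H2_iff_square_summable)

text \<open>
  By Parseval, the squared distance from the dilation to \<open>h\<close> is the sum of
  \<open>|a n|^2 * (1 - r^n)^2\<close>. Each term tends to zero and is dominated by \<open>|a n|^2\<close>, so
  Tannery's theorem applies.
\<close>

lemma dilation_tendsto:
  assumes f: "f \<in> H2" and h: "l2_series h (taylor_coeff f)"
  shows "((\<lambda>r. l2sq (\<lambda>\<zeta>. f (of_real r * \<zeta>) - h \<zeta>)) \<longlongrightarrow> 0) (at_left 1)"
proof -
  let ?a = "\<lambda>n. (cmod (taylor_coeff f n))\<^sup>2"
  have eq: "l2sq (\<lambda>\<zeta>. f (of_real r * \<zeta>) - h \<zeta>) = (\<Sum>n. ?a n * (1 - r ^ n)\<^sup>2)" if "0 < r" "r < 1" for r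
  proof -
    have "l2_series (\<lambda>\<zeta>. f (of_real r * \<zeta>) - h \<zeta>)
        (\<lambda>n. taylor_coeff f n * of_real r ^ n - taylor_coeff f n)"
      by (intro l2_series_diff h l2_series_dilation_Taylor) (use H2D[OF f] that in auto)
    from l2_series_Parseval[OF this] have "l2sq (\<lambda>\<zeta>. f (of_real r * \<zeta>) - h \<zeta>) =
        (\<Sum>n. (cmod (taylor_coeff f n * of_real r ^ n - taylor_coeff f n))\<^sup>2)"
      by (rule sums_unique)
    also have "taylor_coeff f n * of_real r ^ n - taylor_coeff f n =
        taylor_coeff f n * of_real (r ^ n - 1)" for n
      by (simp add: algebra_simps)
    then have "(\<lambda>n. (cmod (taylor_coeff f n * of_real r ^ n - taylor_coeff f n))\<^sup>2) =
        (\<lambda>n. ?a n * (1 - r ^ n)\<^sup>2)"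
      by (simp add: norm_mult power_mult_distrib power2_commute del: of_real_diff of_real_power)
    finally show ?thesis .
  qed
  have "((\<lambda>r. \<Sum>n. ?a n * (1 - r ^ n)\<^sup>2) \<longlongrightarrow> (\<Sum>n. 0)) (at_left (1::real))"
  proof (rule tannerys_theorem[THEN conjunct2, THEN conjunct2])
    show "((\<lambda>r. ?a k * (1 - r ^ k)\<^sup>2) \<longlongrightarrow> 0) (at_left 1)" for k
      by (auto intro!: tendsto_eq_intros)
    have "\<forall>\<^sub>F (r::real) in at_left 1. \<forall>k. norm (?a k * (1 - r ^ k)\<^sup>2) \<le> ?a k"
      using eventually_at_left_real[of 0 1, simplified]
    proof eventually_elim
      case (elim r)
      show ?case
      proof
        fix k
        have "0 \<le> 1 - r ^ k" "1 - r ^ k \<le> 1" using elim by (auto simp: power_le_one)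
        then have "(1 - r ^ k)\<^sup>2 \<le> 1" by (simp add: power_le_one)
        then show "norm (?a k * (1 - r ^ k)\<^sup>2) \<le> ?a k"
          by (simp add: mult_left_le)
      qed
    qed
    then show "\<forall>\<^sub>F (k, r) in at_top \<times>\<^sub>F at_left (1::real). norm (?a k * (1 - r ^ k)\<^sup>2) \<le> ?a k"
      by (rule eventually_mono[OF eventually_prodI[OF eventually_True]]) auto
  qed (use H2D[OF f] in auto)
  moreover have "\<forall>\<^sub>F r in at_left 1. (\<Sum>n. ?a n * (1 - r ^ n)\<^sup>2) = l2sq (\<lambda>\<zeta>. f (of_real r * \<zeta>) - h \<zeta>)"
    using eventually_at_left_real[of 0 1, simplified] by eventually_elim (simp add: eq)
  ultimately show ?thesis
    unfolding suminf_zero by (rule Lim_transform_eventually)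
qed

lemma dilation_L2T:
  assumes "f \<in> H2" "0 \<le> r" "r < 1" shows "(\<lambda>\<zeta>. f (of_real r * \<zeta>)) \<in> L2T"
  by (rule l2_seriesD[OF l2_series_dilation_Taylor]) (use H2D[OF assms(1)] assms in auto)

lemma has_boundary_function_bv: assumes "f \<in> H2" shows "has_boundary_function f (bv f)"
proof -
  obtain h where h: "l2_series h (taylor_coeff f)"
    using Riesz_Fischer[OF H2D(3)[OF assms]] by blast
  then have "has_boundary_function f h"
    using dilation_tendsto[OF assms h] l2_seriesD[OF h]
    by (simp add: has_boundary_function_def l2sq_def)
  then show ?thesis unfolding bv_def by (rule someI[of "has_boundary_function f"])
qed

lemma bv_L2T [simp]: "f \<in> H2 \<Longrightarrow> bv f \<in> L2T"
  using has_boundary_function_bv by (simp add: has_boundary_function_def)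

lemma bv_tendsto:
  "f \<in> H2 \<Longrightarrow> ((\<lambda>r. l2sq (\<lambda>\<zeta>. f (of_real r * \<zeta>) - bv f \<zeta>)) \<longlongrightarrow> 0) (at_left 1)"
  using has_boundary_function_bv by (simp add: has_boundary_function_def l2sq_def)

lemma bv_measurable: "f \<in> H2 \<Longrightarrow> bv f \<in> borel_measurable borel"
  using bv_L2T L2T_iff by blast

text \<open>
  Convergence in \<open>L\<^sup>2\<close> gives convergence almost everywhere along some sequence of radii.
  Three functions share one sequence, which is what comparing \<open>f\<close> and \<open>g\<close> with their sum or
  product requires: pointwise identities in the disc pass to the boundary.
\<close>

lemma dilations_converge_AE:
  assumes f: "f \<in> H2" and g: "g \<in> H2" and h: "h \<in> H2"
  obtains \<rho> :: "nat \<Rightarrow> real" where "\<And>j. 0 < \<rho> j" "\<And>j. \<rho> j < 1" "\<rho> \<longlonglongrightarrow> 1"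
    "AE \<zeta> in circle. (\<lambda>j. f (of_real (\<rho> j) * \<zeta>)) \<longlonglongrightarrow> bv f \<zeta> \<and>
      (\<lambda>j. g (of_real (\<rho> j) * \<zeta>)) \<longlonglongrightarrow> bv g \<zeta> \<and> (\<lambda>j. h (of_real (\<rho> j) * \<zeta>)) \<longlonglongrightarrow> bv h \<zeta>"
proof -
  \<comment> \<open>The shift by two keeps all radii strictly between zero and one.\<close>
  define s where "s = (\<lambda>n::nat. 1 - 1 / real (n + 2))"
  have s: "0 < s n" "s n < 1" for n by (simp_all add: s_def)
  have s1: "s \<longlonglongrightarrow> 1"
    using tendsto_diff[OF tendsto_const LIMSEQ_ignore_initial_segment[OF lim_1_over_n, of 2], of "1::real"]
    by (simp add: s_def)
  then have lim: "filterlim s (at_left 1) sequentially"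
    unfolding filterlim_at using s by (simp add: less_imp_neq)
  let ?D = "\<lambda>f n \<zeta>. (cmod (f (of_real (s n) * \<zeta>) - bv f \<zeta>))\<^sup>2"
  have D: "integrable circle (?D f n)" and lD: "(\<lambda>n. \<integral>\<zeta>. ?D f n \<zeta> \<partial>circle) \<longlonglongrightarrow> 0" if "f \<in> H2" for f n
    using filterlim_compose[OF bv_tendsto[OF that] lim] s[of n] that
    by (auto simp: l2sq_def intro!: L2T_integrable L2T_diff dilation_L2T)
  let ?u = "\<lambda>n \<zeta>. ?D f n \<zeta> + ?D g n \<zeta> + ?D h n \<zeta>"
  have "(\<lambda>n. \<integral>\<zeta>. norm (?u n \<zeta>) \<partial>circle) \<longlonglongrightarrow> 0 + 0 + 0"
    using tendsto_add[OF tendsto_add[OF lD[OF f] lD[OF g]] lD[OF h]] by (simp add: D f g h)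
  then obtain r where r: "strict_mono r" "AE \<zeta> in circle. (\<lambda>n. ?u (r n) \<zeta>) \<longlonglongrightarrow> 0"
    using tendsto_L1_AE_subseq[of circle ?u] by (auto simp: D f g h)
  show ?thesis
  proof (rule that[of "\<lambda>j. s (r j)"])
    have step: "(\<lambda>j. F (of_real (s (r j)) * \<zeta>)) \<longlonglongrightarrow> bv F \<zeta>"
      if "(\<lambda>n. ?u (r n) \<zeta>) \<longlonglongrightarrow> 0" "\<And>n. ?D F (r n) \<zeta> \<le> ?u (r n) \<zeta>" for \<zeta> F
    proof -
      have "(\<lambda>n. ?D F (r n) \<zeta>) \<longlonglongrightarrow> 0"
        by (rule tendsto_sandwich[OF _ _ tendsto_const that(1)]) (use that(2) in auto)
      then have "(\<lambda>n. sqrt (?D F (r n) \<zeta>)) \<longlonglongrightarrow> sqrt 0" by (rule tendsto_real_sqrt)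
      then show ?thesis by (simp add: tendsto_norm_zero_iff LIM_zero_iff)
    qed
    show "AE \<zeta> in circle. (\<lambda>j. f (of_real (s (r j)) * \<zeta>)) \<longlonglongrightarrow> bv f \<zeta> \<and>
      (\<lambda>j. g (of_real (s (r j)) * \<zeta>)) \<longlonglongrightarrow> bv g \<zeta> \<and> (\<lambda>j. h (of_real (s (r j)) * \<zeta>)) \<longlonglongrightarrow> bv h \<zeta>"
      using r(2) by eventually_elim (intro conjI step; simp)
    show "(\<lambda>j. s (r j)) \<longlonglongrightarrow> 1"
      using LIMSEQ_subseq_LIMSEQ[OF s1 r(1)] by (simp add: o_def)
  qed (auto simp: s)
qed

text \<open>
  The boundary function is chosen by Hilbert's operator among all limits of the dilations; any two of
  them agree almost everywhere, so it inherits the Fourier expansion of the Riesz--Fischer sum.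
\<close>

lemma bv_series: assumes f: "f \<in> H2" shows "l2_series (bv f) (taylor_coeff f)"
proof -
  obtain h where h: "l2_series h (taylor_coeff f)"
    using Riesz_Fischer[OF H2D(3)[OF f]] by blast
  let ?D = "\<lambda>h r. l2sq (\<lambda>\<zeta>. f (of_real r * \<zeta>) - h \<zeta>)"
  have "((\<lambda>r. 2 * ?D h r + 2 * ?D (bv f) r) \<longlongrightarrow> 2 * 0 + 2 * 0) (at_left 1)"
    by (intro tendsto_intros dilation_tendsto bv_tendsto f h)
  moreover have "\<forall>\<^sub>F r in at_left 1. l2sq (\<lambda>\<zeta>. h \<zeta> - bv f \<zeta>) \<le> 2 * ?D h r + 2 * ?D (bv f) r"
    using eventually_at_left_real[of 0 1, simplified]
  proof eventually_elim
    case (elim r)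
    then show ?case
      using l2sq_triangle[OF l2_seriesD[OF h] dilation_L2T[OF f] bv_L2T[OF f], of r]
      by (simp add: l2sq_commute)
  qed
  ultimately have "l2sq (\<lambda>\<zeta>. h \<zeta> - bv f \<zeta>) \<le> 2 * 0 + 2 * 0"
    by (intro tendsto_lowerbound) auto
  then have "AE \<zeta> in circle. h \<zeta> - bv f \<zeta> = 0"
    using l2sq_nonneg[of "\<lambda>\<zeta>. h \<zeta> - bv f \<zeta>"]
    by (intro l2sq_eq_0 L2T_diff l2_seriesD[OF h] bv_L2T f) simp
  then have "l2sq (\<lambda>\<zeta>. fourier_sum c N \<zeta> - bv f \<zeta>) = l2sq (\<lambda>\<zeta>. fourier_sum c N \<zeta> - h \<zeta>)" for c N
    unfolding l2sq_def using bv_measurable[OF f] L2T_measurable[OF l2_seriesD[OF h]] L2T_measurable[OF L2T_fourier_sum]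
    by (intro integral_cong_AE) auto
  then show ?thesis using h f by (simp add: l2_series_def)
qed

text \<open>
  That the Taylor coefficients of the sum are the given numbers follows by comparing Fourier
  coefficients of the dilation by \<open>1/2\<close>.
\<close>

lemma H2_of_coefficients:
  assumes "summable (\<lambda>n. (cmod (c n))\<^sup>2)"
  obtains f where "f \<in> H2" "taylor_coeff f = c"
proof -
  define f where "f z = (if z \<in> disc then \<Sum>n. c n * z ^ n else 0)" for z
  have "(\<lambda>n. (cmod (c n))\<^sup>2) \<longlonglongrightarrow> 0" by (rule summable_LIMSEQ_zero[OF assms])
  then have "Bseq (\<lambda>n. (cmod (c n))\<^sup>2)" by (intro convergent_imp_Bseq convergentI)
  then obtain K where K: "K > 0" "\<And>n. norm ((cmod (c n))\<^sup>2) \<le> K" by (auto simp: Bseq_def)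
  have cK: "cmod (c n) \<le> sqrt K" for n
    using K(2)[of n] by (intro real_le_rsqrt) auto
  have sums: "(\<lambda>n. c n * z ^ n) sums f z" if "z \<in> disc" for z
  proof -
    have "summable (\<lambda>n. sqrt K * cmod z ^ n)" using that by (intro summable_mult summable_geometric) simp
    then have "summable (\<lambda>n. c n * z ^ n)"
      by (rule summable_comparison_test'[where N = 0]) (simp add: norm_mult norm_power mult_right_mono cK)
    then show ?thesis using that by (simp add: f_def summable_sums)
  qed
  have hol: "f holomorphic_on disc"
    by (rule power_series_holomorphic[where a = c]) (use sums in simp)
  have zero: "f z = 0" if "z \<notin> disc" for z using that by (simp add: f_def)
  have "taylor_coeff f n = c n" for n
  proof -
    have "taylor_coeff f n * of_real (1/2) ^ n = c n * of_real (1/2) ^ n"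
      using l2_series_coeff[OF l2_series_dilation[OF borel_measurable_disc_function[OF hol zero] sums, of "1/2"]]
        l2_series_coeff[OF l2_series_dilation_Taylor[OF hol zero, of "1/2"]] by simp
    then show ?thesis by simp
  qed
  then have "taylor_coeff f = c" by auto
  moreover from this have "f \<in> H2" using hol zero assms by (simp add: H2_iff_square_summable)
  ultimately show ?thesis using that by blast
qed

section \<open>Algebra of boundary functions\<close>

lemma H2_iff_bounded:
  "f \<in> H2 \<longleftrightarrow> f holomorphic_on disc \<and> (\<forall>z. z \<notin> disc \<longrightarrow> f z = 0) \<and>
    (\<exists>C. \<forall>r\<in>{0..<1}. l2sq (\<lambda>\<zeta>. f (of_real r * \<zeta>)) \<le> C)"
  unfolding H2_def bdd_above_def l2sq_def by blast

lemma disc_const_simps [simp]: "z \<in> disc \<Longrightarrow> disc_const c z = c" "z \<notin> disc \<Longrightarrow> disc_const c z = 0"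
  by (auto simp: disc_const_def)

lemma disc_const_Hinf [simp]: "disc_const c \<in> Hinf"
proof -
  have "disc_const c holomorphic_on disc"
    by (rule holomorphic_transform[of "\<lambda>_. c"]) auto
  moreover have "bounded (disc_const c ` disc)"
    by (rule finite_imp_bounded[OF finite_subset[of _ "{c}"]]) auto
  ultimately show ?thesis by (simp add: Hinf_def)
qed

lemma circle_dilation_in_disc:
  assumes "cmod \<zeta> = 1" "0 \<le> r" "r < 1" shows "of_real r * \<zeta> \<in> disc"
  using assms by (simp add: norm_mult)

lemma disc_const_H2 [simp]: "disc_const c \<in> H2"
proof -
  have "l2sq (\<lambda>\<zeta>. disc_const c (of_real r * \<zeta>)) \<le> (cmod c)\<^sup>2" if r: "r \<in> {0..<1}" for r :: real
  proof -
    have [measurable]: "disc_const c \<in> borel_measurable borel"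
      by (rule borel_measurable_disc_function) (use disc_const_Hinf[of c] in \<open>auto simp: Hinf_def\<close>)
    have "l2sq (\<lambda>\<zeta>. disc_const c (of_real r * \<zeta>)) = l2sq (\<lambda>_. c)"
      unfolding l2sq_def
    proof (rule integral_cong_AE)
      show "AE \<zeta> in circle. (cmod (disc_const c (of_real r * \<zeta>)))\<^sup>2 = (cmod c)\<^sup>2"
        using AE_circle_norm
        by eventually_elim (use r circle_dilation_in_disc in \<open>simp del: mem_ball\<close>)
    qed auto
    then show ?thesis by (simp add: l2sq_def)
  qed
  then have "\<exists>C. \<forall>r\<in>{0..<1}. l2sq (\<lambda>\<zeta>. disc_const c (of_real r * \<zeta>)) \<le> C" by blast
  then show ?thesis using disc_const_Hinf[of c] unfolding H2_iff_bounded Hinf_def by blast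
qed

lemma H2_add: assumes "f \<in> H2" "g \<in> H2" shows "f + g \<in> H2"
proof -
  obtain C D where
    C: "\<And>r. r \<in> {0..<1} \<Longrightarrow> l2sq (\<lambda>\<zeta>. f (of_real r * \<zeta>)) \<le> C" and
    D: "\<And>r. r \<in> {0..<1} \<Longrightarrow> l2sq (\<lambda>\<zeta>. g (of_real r * \<zeta>)) \<le> D"
    using assms unfolding H2_iff_bounded by blast
  have "l2sq (\<lambda>\<zeta>. (f + g) (of_real r * \<zeta>)) \<le> 2 * C + 2 * D" if r: "r \<in> {0..<1}" for r
    using l2sq_add_le[OF dilation_L2T[OF assms(1), of r] dilation_L2T[OF assms(2), of r]] C[OF r] D[OF r] r
    by simp
  then have "\<exists>C. \<forall>r\<in>{0..<1}. l2sq (\<lambda>\<zeta>. (f + g) (of_real r * \<zeta>)) \<le> C" by blast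
  moreover have "f + g holomorphic_on disc"
    unfolding plus_fun_def by (intro holomorphic_intros H2D assms)
  moreover have "\<forall>z. z \<notin> disc \<longrightarrow> (f + g) z = 0"
    using H2D(2)[OF assms(1)] H2D(2)[OF assms(2)] by simp
  ultimately show ?thesis unfolding H2_iff_bounded by blast
qed

text \<open>
  A bounded factor multiplies the integral means by at most the square of its supremum norm.
\<close>

lemma H2_mult:
  assumes \<phi>: "\<phi> \<in> Hinf" and f: "f \<in> H2" shows "\<phi> * f \<in> H2"
proof -
  have hol: "\<phi> holomorphic_on disc" and zero: "\<And>z. z \<notin> disc \<Longrightarrow> \<phi> z = 0"
    using \<phi> by (auto simp: Hinf_def)
  obtain B where B: "\<And>z. z \<in> disc \<Longrightarrow> cmod (\<phi> z) \<le> B"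
    using \<phi> unfolding Hinf_def bounded_iff by blast
  obtain C where C: "\<And>r. r \<in> {0..<1} \<Longrightarrow> l2sq (\<lambda>\<zeta>. f (of_real r * \<zeta>)) \<le> C"
    using f unfolding H2_iff_bounded by blast
  have [measurable]: "\<phi> \<in> borel_measurable borel"
    by (rule borel_measurable_disc_function[OF hol zero])
  have "l2sq (\<lambda>\<zeta>. (\<phi> * f) (of_real r * \<zeta>)) \<le> B\<^sup>2 * C" if r: "r \<in> {0..<1}" for r :: real
  proof -
    have fr: "(\<lambda>\<zeta>. f (of_real r * \<zeta>)) \<in> L2T" using r by (intro dilation_L2T f) auto
    have AE_B: "AE \<zeta> in circle. cmod (\<phi> (of_real r * \<zeta>)) \<le> B"
      using AE_circle_norm by eventually_elim (use r in \<open>auto intro!: B simp: norm_mult\<close>)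
    have "l2sq (\<lambda>\<zeta>. \<phi> (of_real r * \<zeta>) * f (of_real r * \<zeta>)) \<le> (\<integral>\<zeta>. B\<^sup>2 * (cmod (f (of_real r * \<zeta>)))\<^sup>2 \<partial>circle)"
      unfolding l2sq_def
    proof (rule integral_mono_AE)
      show "integrable circle (\<lambda>\<zeta>. (cmod (\<phi> (of_real r * \<zeta>) * f (of_real r * \<zeta>)))\<^sup>2)"
        by (rule L2T_integrable[OF L2T_mult_bounded[OF _ AE_B fr]]) measurable
      show "AE \<zeta> in circle. (cmod (\<phi> (of_real r * \<zeta>) * f (of_real r * \<zeta>)))\<^sup>2 \<le>
          B\<^sup>2 * (cmod (f (of_real r * \<zeta>)))\<^sup>2"
        using AE_B by eventually_elim
          (auto simp: norm_mult power_mult_distrib intro!: mult_right_mono power_mono)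
    qed (use L2T_integrable[OF fr] in auto)
    also have "\<dots> = B\<^sup>2 * l2sq (\<lambda>\<zeta>. f (of_real r * \<zeta>))" by (simp add: l2sq_def)
    also have "\<dots> \<le> B\<^sup>2 * C" by (intro mult_left_mono C r) auto
    finally show ?thesis by simp
  qed
  then have "\<exists>C. \<forall>r\<in>{0..<1}. l2sq (\<lambda>\<zeta>. (\<phi> * f) (of_real r * \<zeta>)) \<le> C" by blast
  moreover have "\<phi> * f holomorphic_on disc"
    unfolding times_fun_def by (intro holomorphic_intros hol H2D f)
  moreover have "\<forall>z. z \<notin> disc \<longrightarrow> (\<phi> * f) z = 0" using zero by simp
  ultimately show ?thesis unfolding H2_iff_bounded by blast
qed

lemma disc_const_mult:
  assumes "\<And>z. z \<notin> disc \<Longrightarrow> f z = 0" shows "disc_const c * f = cscale c f"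
proof
  fix z show "(disc_const c * f) z = cscale c f z"
    by (cases "z \<in> disc") (simp_all add: cscale_def assms del: mem_ball)
qed

lemma disc_const_mult_H2: "f \<in> H2 \<Longrightarrow> disc_const c * f = cscale c f"
  by (rule disc_const_mult) (rule H2D(2))

lemma cscale_1 [simp]: "cscale 1 f = f"
  by (simp add: cscale_def)

lemma diff_eq_add_cscale: "f - g = f + cscale (-1) g"
  by (simp add: fun_eq_iff cscale_def)

lemma H2_cscale: assumes "f \<in> H2" shows "cscale c f \<in> H2"
  using H2_mult[OF disc_const_Hinf assms, of c] disc_const_mult_H2[OF assms] by simp

lemma H2_diff: assumes "f \<in> H2" "g \<in> H2" shows "f - g \<in> H2"
  unfolding diff_eq_add_cscale[of f g] by (intro H2_add H2_cscale assms)

lemma H2_0 [simp]: "0 \<in> H2"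
  using H2_diff[OF disc_const_H2[of 0] disc_const_H2[of 0]] by simp

lemma Hinf_H2: assumes "\<phi> \<in> Hinf" shows "\<phi> \<in> H2"
proof -
  have "\<phi> * disc_const 1 = disc_const 1 * \<phi>" by (simp add: mult.commute)
  also have "\<dots> = \<phi>" using assms disc_const_mult[of \<phi> 1] by (simp add: Hinf_def)
  finally show ?thesis using H2_mult[OF assms disc_const_H2[of 1]] by simp
qed

lemma bv_add:
  assumes "f \<in> H2" "g \<in> H2"
  shows "AE \<zeta> in circle. bv (f + g) \<zeta> = bv f \<zeta> + bv g \<zeta>"
proof -
  obtain \<rho> :: "nat \<Rightarrow> real" where "AE \<zeta> in circle. (\<lambda>j. f (of_real (\<rho> j) * \<zeta>)) \<longlonglongrightarrow> bv f \<zeta> \<and>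
      (\<lambda>j. g (of_real (\<rho> j) * \<zeta>)) \<longlonglongrightarrow> bv g \<zeta> \<and>
      (\<lambda>j. (f + g) (of_real (\<rho> j) * \<zeta>)) \<longlonglongrightarrow> bv (f + g) \<zeta>"
    by (rule dilations_converge_AE[OF assms H2_add[OF assms]])
  then show ?thesis
    by eventually_elim (auto intro: LIMSEQ_unique tendsto_add)
qed

lemma bv_mult:
  assumes \<phi>: "\<phi> \<in> Hinf" and f: "f \<in> H2"
  shows "AE \<zeta> in circle. bv (\<phi> * f) \<zeta> = bv \<phi> \<zeta> * bv f \<zeta>"
proof -
  obtain \<rho> :: "nat \<Rightarrow> real" where "AE \<zeta> in circle. (\<lambda>j. \<phi> (of_real (\<rho> j) * \<zeta>)) \<longlonglongrightarrow> bv \<phi> \<zeta> \<and>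
      (\<lambda>j. f (of_real (\<rho> j) * \<zeta>)) \<longlonglongrightarrow> bv f \<zeta> \<and>
      (\<lambda>j. (\<phi> * f) (of_real (\<rho> j) * \<zeta>)) \<longlonglongrightarrow> bv (\<phi> * f) \<zeta>"
    by (rule dilations_converge_AE[OF Hinf_H2[OF \<phi>] f H2_mult[OF assms]])
  then show ?thesis
    by eventually_elim (auto intro: LIMSEQ_unique tendsto_mult)
qed

text \<open>
  If \<open>f\<close> agrees in the disc with a function continuous across the circle, the latter gives the
  boundary values. This covers the constants and the coordinate function.
\<close>

lemma bv_eqI:
  assumes "f \<in> H2" and "\<And>\<zeta> r. cmod \<zeta> = 1 \<Longrightarrow> 0 < r \<Longrightarrow> r < 1 \<Longrightarrow> f (of_real r * \<zeta>) = F (of_real r * \<zeta>)"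
    and F: "continuous_on UNIV F"
  shows "AE \<zeta> in circle. bv f \<zeta> = F \<zeta>"
proof -
  obtain \<rho> :: "nat \<Rightarrow> real" where \<rho>: "\<And>j. 0 < \<rho> j" "\<And>j. \<rho> j < 1" "\<rho> \<longlonglongrightarrow> 1" and
    conv: "AE \<zeta> in circle. (\<lambda>j. f (of_real (\<rho> j) * \<zeta>)) \<longlonglongrightarrow> bv f \<zeta> \<and>
      (\<lambda>j. f (of_real (\<rho> j) * \<zeta>)) \<longlonglongrightarrow> bv f \<zeta> \<and> (\<lambda>j. f (of_real (\<rho> j) * \<zeta>)) \<longlonglongrightarrow> bv f \<zeta>"
    by (rule dilations_converge_AE[OF assms(1) assms(1) assms(1)]) (rule that)
  from conv AE_circle_norm show ?thesis
  proof eventually_elim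
    case (elim \<zeta>)
    have "isCont F \<zeta>" using F by (simp add: continuous_on_eq_continuous_at)
    moreover have "(\<lambda>j. of_real (\<rho> j) * \<zeta>) \<longlonglongrightarrow> \<zeta>"
      using tendsto_mult_right[OF tendsto_of_real[OF \<rho>(3)], of \<zeta>] by simp
    ultimately have "(\<lambda>j. F (of_real (\<rho> j) * \<zeta>)) \<longlonglongrightarrow> F \<zeta>" by (rule isCont_tendsto_compose)
    then show ?case using elim \<rho> by (auto simp: assms(2) intro: LIMSEQ_unique)
  qed
qed

lemma bv_bounded:
  assumes \<phi>: "\<phi> \<in> Hinf"
  shows "\<exists>B. AE \<zeta> in circle. cmod (bv \<phi> \<zeta>) \<le> B"
proof -
  obtain B where B: "\<And>z. z \<in> disc \<Longrightarrow> cmod (\<phi> z) \<le> B"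
    using \<phi> unfolding Hinf_def bounded_iff by blast
  obtain \<rho> :: "nat \<Rightarrow> real" where \<rho>: "\<And>j. 0 < \<rho> j" "\<And>j. \<rho> j < 1" and
    conv: "AE \<zeta> in circle. (\<lambda>j. \<phi> (of_real (\<rho> j) * \<zeta>)) \<longlonglongrightarrow> bv \<phi> \<zeta> \<and>
      (\<lambda>j. \<phi> (of_real (\<rho> j) * \<zeta>)) \<longlonglongrightarrow> bv \<phi> \<zeta> \<and> (\<lambda>j. \<phi> (of_real (\<rho> j) * \<zeta>)) \<longlonglongrightarrow> bv \<phi> \<zeta>"
    by (rule dilations_converge_AE[OF Hinf_H2[OF \<phi>] Hinf_H2[OF \<phi>] Hinf_H2[OF \<phi>]]) (rule that)
  from conv AE_circle_norm have "AE \<zeta> in circle. cmod (bv \<phi> \<zeta>) \<le> B"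
  proof eventually_elim
    case (elim \<zeta>)
    have "cmod (\<phi> (of_real (\<rho> j) * \<zeta>)) \<le> B" for j
      using elim \<rho>[of j] by (intro B circle_dilation_in_disc) auto
    then show ?case
      using elim by (intro tendsto_upperbound[OF tendsto_norm]) auto
  qed
  then show ?thesis by blast
qed

text \<open>
  The coordinate function. Multiplication by it is the forward shift, whose adjoint is the backward
  shift.
\<close>

definition disc_id :: "complex \<Rightarrow> complex"
  where "disc_id = (\<lambda>z. if z \<in> disc then z else 0)"

lemma disc_id_Hinf: "disc_id \<in> Hinf"
proof -
  have "disc_id holomorphic_on disc"
    by (rule holomorphic_transform[of "\<lambda>z. z"]) (auto simp: disc_id_def)
  moreover have "bounded (disc_id ` disc)"
    unfolding bounded_iff by (rule exI[of _ 1]) (auto simp: disc_id_def)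
  ultimately show ?thesis by (simp add: Hinf_def disc_id_def)
qed

lemma bv_disc_id: "AE \<zeta> in circle. bv disc_id \<zeta> = \<zeta>"
  using disc_id_Hinf by (intro bv_eqI Hinf_H2) (auto simp: disc_id_def norm_mult)

lemma bv_disc_const: "AE \<zeta> in circle. bv (disc_const c) \<zeta> = c"
  by (rule bv_eqI) (auto simp: norm_mult)

lemma bv_cscale:
  assumes "f \<in> H2" shows "AE \<zeta> in circle. bv (cscale c f) \<zeta> = c * bv f \<zeta>"
  using bv_mult[OF disc_const_Hinf assms, of c] bv_disc_const[of c]
  unfolding disc_const_mult_H2[OF assms]
  by eventually_elim simp

text \<open>
  The pointwise inverse vanishes outside the disc because \<open>inverse 0 = 0\<close>, so it coincides with
  the inverse in the algebra.
\<close>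

lemma Hinf_inv_Hinf:
  assumes "Hinf_invertible f"
  shows "Hinf_inv f \<in> Hinf" "f * Hinf_inv f = disc_const 1" "f \<in> Hinf"
proof -
  obtain h where h: "f \<in> Hinf" "h \<in> Hinf" "f * h = disc_const 1"
    using assms by (auto simp: Hinf_invertible_def)
  have "Hinf_inv f z = h z" for z
  proof (cases "z \<in> disc")
    case True
    then have "f z * h z = 1" using fun_cong[OF h(3), of z] by (simp del: mem_ball)
    then show ?thesis by (simp add: Hinf_inv_def inverse_unique)
  next
    case False
    then show ?thesis using h by (simp add: Hinf_inv_def Hinf_def)
  qed
  then have "Hinf_inv f = h" by auto
  then show "Hinf_inv f \<in> Hinf" "f * Hinf_inv f = disc_const 1" "f \<in> Hinf" using h by auto
qed

lemma bv_Hinf_inv: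
  assumes "Hinf_invertible f"
  shows "AE \<zeta> in circle. bv (Hinf_inv f) \<zeta> = inverse (bv f \<zeta>)"
  using bv_mult[OF Hinf_inv_Hinf(3)[OF assms] Hinf_H2[OF Hinf_inv_Hinf(1)[OF assms]]] bv_disc_const[of 1]
  unfolding Hinf_inv_Hinf(2)[OF assms]
  by eventually_elim (metis inverse_unique)

lemma Hinf_inv_cancel:
  assumes "Hinf_invertible f" "k \<in> H2"
  shows "f * (Hinf_inv f * k) = k" "Hinf_inv f * (f * k) = k"
proof -
  have "f * (Hinf_inv f * k) = disc_const 1 * k"
    unfolding Hinf_inv_Hinf(2)[OF assms(1), symmetric] by (simp add: mult.assoc)
  also have "\<dots> = k" by (simp add: disc_const_mult_H2 assms)
  finally show "f * (Hinf_inv f * k) = k" .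
  then show "Hinf_inv f * (f * k) = k" by (simp add: mult.left_commute)
qed

section \<open>The Hilbert space structure of the Hardy space\<close>

lemma H2_inner_cong_L2:
  assumes "f \<in> H2" "k \<in> H2" "AE \<zeta> in circle. bv f \<zeta> = h \<zeta>" "AE \<zeta> in circle. bv k \<zeta> = h' \<zeta>"
    "h \<in> borel_measurable borel" "h' \<in> borel_measurable borel"
  shows "H2_inner f k = L2_inner h h'"
  unfolding H2_inner_def using assms by (intro L2_inner_cong bv_measurable)

lemma H2_inner_add_left:
  assumes "f \<in> H2" "g \<in> H2" "k \<in> H2"
  shows "H2_inner (f + g) k = H2_inner f k + H2_inner g k"
proof -
  have "H2_inner (f + g) k = L2_inner (\<lambda>\<zeta>. bv f \<zeta> + bv g \<zeta>) (bv k)"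
    using assms bv_measurable[OF assms(1)] bv_measurable[OF assms(2)]
    by (intro H2_inner_cong_L2 H2_add bv_add bv_measurable) auto
  then show ?thesis using assms by (simp add: L2_inner_add_left H2_inner_def)
qed

lemma H2_inner_cscale_left:
  assumes "f \<in> H2" "k \<in> H2"
  shows "H2_inner (cscale c f) k = c * H2_inner f k"
proof -
  have "H2_inner (cscale c f) k = L2_inner (\<lambda>\<zeta>. c * bv f \<zeta>) (bv k)"
    using assms bv_measurable[OF assms(1)]
    by (intro H2_inner_cong_L2 H2_cscale bv_cscale bv_measurable) auto
  then show ?thesis by (simp add: L2_inner_scale_left H2_inner_def)
qed

lemma H2_inner_commute: "H2_inner f k = cnj (H2_inner k f)"
  unfolding H2_inner_def by (rule L2_inner_commute)

lemma H2_inner_0 [simp]: "k \<in> H2 \<Longrightarrow> H2_inner 0 k = 0" "k \<in> H2 \<Longrightarrow> H2_inner k 0 = 0"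
proof -
  show *: "H2_inner 0 k = 0" if "k \<in> H2" for k
    using H2_inner_cscale_left[OF H2_0 that, of 0] by simp
  show "H2_inner k 0 = 0" if "k \<in> H2"
    using *[OF that] by (subst H2_inner_commute) simp
qed

lemma H2_inner_cscale_right:
  assumes "f \<in> H2" "k \<in> H2"
  shows "H2_inner f (cscale c k) = cnj c * H2_inner f k"
  by (subst (1 2) H2_inner_commute) (simp add: H2_inner_cscale_left assms)

lemma H2_inner_diff_left:
  assumes "f \<in> H2" "g \<in> H2" "k \<in> H2"
  shows "H2_inner (f - g) k = H2_inner f k - H2_inner g k"
  unfolding diff_eq_add_cscale[of f g]
  by (subst H2_inner_add_left[OF assms(1) H2_cscale[OF assms(2)] assms(3)])
    (subst H2_inner_cscale_left[OF assms(2,3)], simp)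

lemma H2_norm_eq: "H2_norm f = sqrt (l2sq (bv f))"
  by (simp add: H2_norm_def l2sq_def)

lemma H2_inner_self: "H2_inner f f = of_real ((H2_norm f)\<^sup>2)"
  by (simp add: H2_inner_def L2_inner_self H2_norm_eq l2sq_nonneg del: of_real_power)

lemma H2_inner_self_eq_0:
  assumes f: "f \<in> H2" and "H2_inner f f = 0" shows "f = 0"
proof
  fix z
  have "l2sq (bv f) = 0" using assms(2) by (simp add: H2_inner_def L2_inner_self)
  then have s: "(\<lambda>n. (cmod (taylor_coeff f n))\<^sup>2) sums 0" using l2_series_Parseval[OF bv_series[OF f]] by simp
  have "(cmod (taylor_coeff f n))\<^sup>2 = 0" for n
    using s sums_unique[OF s] suminf_eq_zero_iff[OF sums_summable[OF s]] by simp
  then have "f z = 0" if "z \<in> disc"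
    using Taylor_sums[OF H2D(1)[OF f] that] by (simp add: sums_iff)
  then show "f z = 0 z" using H2D(2)[OF f] by (cases "z \<in> disc") auto
qed

lemma H2_norm_eq_0: assumes "f \<in> H2" shows "H2_norm f = 0 \<longleftrightarrow> f = 0"
proof -
  have "H2_inner 0 0 = H2_inner (0 - 0) 0" by simp
  also have "\<dots> = 0" by (subst H2_inner_diff_left) auto
  finally have "H2_norm 0 = 0" by (simp add: H2_inner_self)
  then show ?thesis using H2_inner_self_eq_0[OF assms] by (auto simp: H2_inner_self)
qed

lemma H2_ext:
  assumes "f \<in> H2" "g \<in> H2" and "\<And>k. k \<in> H2 \<Longrightarrow> H2_inner f k = H2_inner g k"
  shows "f = g"
proof -
  have "H2_inner (f - g) (f - g) = 0"
    using assms by (simp add: H2_inner_diff_left H2_diff)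
  then show ?thesis using H2_inner_self_eq_0[OF H2_diff[OF assms(1,2)]] by simp
qed

lemma H2_inner_tendsto:
  assumes X: "\<And>n. X n \<in> H2" and f: "f \<in> H2" and k: "k \<in> H2" and "(\<lambda>n. H2_norm (X n - f)) \<longlonglongrightarrow> 0"
  shows "(\<lambda>n. H2_inner (X n) k) \<longlonglongrightarrow> H2_inner f k"
proof -
  have "(\<lambda>n. (H2_norm (X n - f))\<^sup>2) \<longlonglongrightarrow> 0\<^sup>2" by (intro tendsto_power assms)
  then have "(\<lambda>n. l2sq (bv (X n - f))) \<longlonglongrightarrow> 0" by (simp add: H2_norm_eq l2sq_nonneg)
  then have "(\<lambda>n. H2_inner (X n - f) k) \<longlonglongrightarrow> 0"
    unfolding H2_inner_def by (rule L2_inner_tendsto_0) (simp_all add: H2_diff X f k)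
  then show ?thesis by (simp add: H2_inner_diff_left X f k LIM_zero_iff)
qed

text \<open>
  Evaluation at the origin is the zeroth Fourier coefficient, that is, the inner product with the
  constant function one.
\<close>

lemma H2_inner_disc_const:
  assumes f: "f \<in> H2" shows "H2_inner (disc_const c) f = c * cnj (f 0)"
proof -
  have "H2_inner (disc_const c) f = L2_inner (\<lambda>_. c) (bv f)"
    by (rule H2_inner_cong_L2) (use f bv_disc_const in \<open>auto intro: bv_measurable\<close>)
  also have "\<dots> = c * cnj (L2_inner (bv f) (\<lambda>\<zeta>. \<zeta> ^ 0))"
    using L2_inner_scale_left[of c "\<lambda>_. 1" "bv f"] by (subst L2_inner_commute[symmetric]) simp
  also have "L2_inner (bv f) (\<lambda>\<zeta>. \<zeta> ^ 0) = f 0"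
    by (subst l2_series_coeff[OF bv_series[OF f]]) (simp add: taylor_coeff_def)
  finally show ?thesis .
qed

section \<open>The orthogonal projection and Toeplitz operators\<close>

text \<open>
  Drop the Fourier coefficients of \<open>h\<close> with negative index; Bessel's inequality makes the others
  square summable. The difference is orthogonal to all monomials, hence to the \<open>L\<^sup>2\<close> limits of
  polynomials, which include all boundary functions.
\<close>

lemma Hardy_projection_exists:
  assumes h: "h \<in> L2T"
  shows "\<exists>f\<in>H2. \<forall>k\<in>H2. L2_inner h (bv k) = H2_inner f k"
proof -
  define c where "c n = L2_inner h (\<lambda>\<zeta>. \<zeta> ^ n)" for n
  have "(\<Sum>n<N. (cmod (c n))\<^sup>2) \<le> l2sq h" for N
    using Bessel_identity[OF h c_def[symmetric], of N] l2sq_nonneg[of "\<lambda>\<zeta>. fourier_sum c N \<zeta> - h \<zeta>"] by simp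
  then have "summable (\<lambda>n. (cmod (c n))\<^sup>2)" by (intro summableI_nonneg_bounded) auto
  then obtain f where f: "f \<in> H2" "taylor_coeff f = c" by (rule H2_of_coefficients)
  let ?d = "\<lambda>\<zeta>. h \<zeta> - bv f \<zeta>"
  have d: "?d \<in> L2T" using h f by (simp add: L2T_diff)
  have "L2_inner (bv f) (\<lambda>\<zeta>. \<zeta> ^ n) = c n" for n
    using l2_series_coeff[OF bv_series[OF f(1)]] f(2) by simp
  then have d0: "L2_inner ?d (\<lambda>\<zeta>. \<zeta> ^ n) = 0" for n
    using h f by (simp add: L2_inner_diff_left c_def)
  have "L2_inner h (bv k) = H2_inner f k" if k: "k \<in> H2" for k
  proof -
    have "(\<lambda>N. L2_inner (fourier_sum (taylor_coeff k) N) ?d) \<longlonglongrightarrow> L2_inner (bv k) ?d"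
      by (rule L2_inner_tendsto) (use bv_series[OF k] d in \<open>auto simp: l2_series_def\<close>)
    moreover have "L2_inner (fourier_sum (taylor_coeff k) N) ?d = 0" for N
      unfolding L2_inner_fourier_sum[OF d] by (subst L2_inner_commute) (simp add: d0)
    ultimately have "L2_inner (bv k) ?d = 0" by (simp add: LIMSEQ_const_iff)
    then have "L2_inner ?d (bv k) = 0" by (subst L2_inner_commute) simp
    then show ?thesis using h f k by (simp add: L2_inner_diff_left H2_inner_def)
  qed
  then show ?thesis using f by blast
qed

lemma proj_H2_eqI:
  assumes h: "h \<in> L2T" and f: "f \<in> H2" and *: "\<And>k. k \<in> H2 \<Longrightarrow> L2_inner h (bv k) = H2_inner f k"
  shows "proj_H2 h = f"
  unfolding proj_H2_def
proof (rule the_equality)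
  show "f \<in> H2 \<and> (\<forall>k\<in>H2. L2_inner (\<lambda>\<zeta>. h \<zeta> - bv f \<zeta>) (bv k) = 0)"
    using h f * by (simp add: L2_inner_diff_left H2_inner_def)
  fix f' assume f': "f' \<in> H2 \<and> (\<forall>k\<in>H2. L2_inner (\<lambda>\<zeta>. h \<zeta> - bv f' \<zeta>) (bv k) = 0)"
  show "f' = f"
  proof (rule H2_ext)
    fix k assume k: "k \<in> H2"
    then have "L2_inner h (bv k) - H2_inner f' k = 0"
      using f' L2_inner_diff_left[OF h bv_L2T bv_L2T, of f' k] by (simp add: H2_inner_def)
    then show "H2_inner f' k = H2_inner f k" using *[OF k] by simp
  qed (use f f' in auto)
qed

lemma proj_H2:
  assumes h: "h \<in> L2T"
  shows "proj_H2 h \<in> H2" "k \<in> H2 \<Longrightarrow> H2_inner (proj_H2 h) k = L2_inner h (bv k)"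
proof -
  obtain f where f: "f \<in> H2" "\<forall>k\<in>H2. L2_inner h (bv k) = H2_inner f k"
    using Hardy_projection_exists[OF h] by blast
  then have "proj_H2 h = f" by (intro proj_H2_eqI h) auto
  then show "proj_H2 h \<in> H2" "k \<in> H2 \<Longrightarrow> H2_inner (proj_H2 h) k = L2_inner h (bv k)"
    using f by auto
qed

text \<open>
  This weak description is the only property of Toeplitz operators used below: a co-analytic factor
  \<open>cnj \<psi>\<close> of the symbol moves to the other side of the inner product as multiplication by
  \<open>\<psi>\<close>, where it stays inside the Hardy space.
\<close>

theorem toeplitz_adjoint:
  assumes \<sigma>: "\<sigma> \<in> borel_measurable borel" "AE \<zeta> in circle. \<sigma> \<zeta> = bv \<phi> \<zeta> * cnj (bv \<psi> \<zeta>)"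
    and \<phi>: "\<phi> \<in> Hinf" and \<psi>: "\<psi> \<in> Hinf" and f: "f \<in> H2"
  shows "toeplitz \<sigma> f \<in> H2"
    and "k \<in> H2 \<Longrightarrow> H2_inner (toeplitz \<sigma> f) k = H2_inner (\<phi> * f) (\<psi> * k)"
proof -
  note [measurable] = \<sigma>(1) bv_measurable[OF f]
  obtain A B where AB: "AE \<zeta> in circle. cmod (bv \<phi> \<zeta>) \<le> A" "AE \<zeta> in circle. cmod (bv \<psi> \<zeta>) \<le> B"
    using bv_bounded[OF \<phi>] bv_bounded[OF \<psi>] by blast
  have "AE \<zeta> in circle. cmod (\<sigma> \<zeta>) \<le> A * B"
    using \<sigma>(2) AB
  proof eventually_elim
    case (elim \<zeta>)
    then show ?case
      using order_trans[OF norm_ge_zero, of "bv \<phi> \<zeta>" A] by (simp add: norm_mult mult_mono)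
  qed
  then have L2: "(\<lambda>\<zeta>. \<sigma> \<zeta> * bv f \<zeta>) \<in> L2T"
    by (intro L2T_mult_bounded bv_L2T f \<sigma>)
  show "toeplitz \<sigma> f \<in> H2" unfolding toeplitz_def by (rule proj_H2(1)[OF L2])
  assume k: "k \<in> H2"
  note [measurable] = bv_measurable[OF k] bv_measurable[OF H2_mult[OF \<phi> f]] bv_measurable[OF H2_mult[OF \<psi> k]]
  have "H2_inner (toeplitz \<sigma> f) k = L2_inner (\<lambda>\<zeta>. \<sigma> \<zeta> * bv f \<zeta>) (bv k)"
    unfolding toeplitz_def by (rule proj_H2(2)[OF L2 k])
  also have "\<dots> = H2_inner (\<phi> * f) (\<psi> * k)"
    unfolding H2_inner_def L2_inner_def
  proof (rule integral_cong_AE)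
    show "AE \<zeta> in circle. \<sigma> \<zeta> * bv f \<zeta> * cnj (bv k \<zeta>) = bv (\<phi> * f) \<zeta> * cnj (bv (\<psi> * k) \<zeta>)"
      using \<sigma>(2) bv_mult[OF \<phi> f] bv_mult[OF \<psi> k] by eventually_elim simp
  qed auto
  finally show "H2_inner (toeplitz \<sigma> f) k = H2_inner (\<phi> * f) (\<psi> * k)" .
qed

text \<open>
  Taking the analytic factor to be one exhibits the operator as an adjoint, so that it inherits
  linearity and commutation relations from multiplication operators.
\<close>

lemma toeplitz_coanalytic:
  assumes \<sigma>: "\<sigma> \<in> borel_measurable borel" "AE \<zeta> in circle. \<sigma> \<zeta> = cnj (bv \<psi> \<zeta>)"
    and \<psi>: "\<psi> \<in> Hinf" and f: "f \<in> H2"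
  shows "toeplitz \<sigma> f \<in> H2"
    and "k \<in> H2 \<Longrightarrow> H2_inner (toeplitz \<sigma> f) k = H2_inner f (\<psi> * k)"
proof -
  have "AE \<zeta> in circle. \<sigma> \<zeta> = bv (disc_const 1) \<zeta> * cnj (bv \<psi> \<zeta>)"
    using \<sigma>(2) bv_disc_const[of 1] by eventually_elim simp
  note T = toeplitz_adjoint[OF \<sigma>(1) this disc_const_Hinf \<psi> f]
  show "toeplitz \<sigma> f \<in> H2" by (rule T)
  show "H2_inner (toeplitz \<sigma> f) k = H2_inner f (\<psi> * k)" if "k \<in> H2"
    by (simp add: T(2)[OF that] disc_const_mult_H2[OF f])
qed

lemma toeplitz_cscale:
  assumes \<sigma>: "\<sigma> \<in> borel_measurable borel" "AE \<zeta> in circle. \<sigma> \<zeta> = cnj (bv \<psi> \<zeta>)"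
    and \<psi>: "\<psi> \<in> Hinf" and f: "f \<in> H2"
  shows "toeplitz \<sigma> (cscale c f) = cscale c (toeplitz \<sigma> f)"
proof (rule H2_ext)
  note T = toeplitz_coanalytic[OF \<sigma> \<psi>]
  show "toeplitz \<sigma> (cscale c f) \<in> H2" "cscale c (toeplitz \<sigma> f) \<in> H2"
    by (intro T H2_cscale f)+
  show "H2_inner (toeplitz \<sigma> (cscale c f)) k = H2_inner (cscale c (toeplitz \<sigma> f)) k" if "k \<in> H2" for k
    using that f by (simp add: T H2_cscale H2_inner_cscale_left H2_mult \<psi>)
qed

section \<open>The backward shift\<close>

lemma taylor_coeff_0 [simp]: "taylor_coeff f 0 = f 0"
  by (simp add: taylor_coeff_def)

text \<open>
  The backward shift deletes the zeroth Taylor coefficient.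
\<close>

lemma backward_shift_H2:
  assumes f: "f \<in> H2" shows "backward_shift f \<in> H2"
proof -
  have "summable (\<lambda>n. (cmod (taylor_coeff f (Suc n)))\<^sup>2)"
    using H2D(3)[OF f] summable_Suc_iff[of "\<lambda>n. (cmod (taylor_coeff f n))\<^sup>2"] by simp
  then obtain F where F: "F \<in> H2" "taylor_coeff F = (\<lambda>n. taylor_coeff f (Suc n))"
    by (rule H2_of_coefficients)
  have "backward_shift f z = F z" for z
  proof (cases "z \<in> disc")
    case True
    have "(\<lambda>n. taylor_coeff f (Suc n) * z ^ n * z) sums (F z * z)"
      using Taylor_sums[OF H2D(1)[OF F(1)] True] F(2) by (intro sums_mult2) simp
    then have "(\<lambda>n. taylor_coeff f (Suc n) * z ^ Suc n) sums (F z * z)" by (simp add: mult_ac)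
    then have "(\<lambda>n. taylor_coeff f n * z ^ n) sums (F z * z + f 0)"
      by (subst (asm) sums_Suc_iff) simp
    then have eq: "f z = F z * z + f 0"
      using Taylor_sums[OF H2D(1)[OF f] True] sums_unique2 by blast
    have "F 0 = deriv f 0" using fun_cong[OF F(2), of 0] by (simp add: taylor_coeff_def)
    then show ?thesis using True eq by (simp add: backward_shift_def)
  next
    case False
    then show ?thesis using H2D(2)[OF F(1)] by (simp add: backward_shift_def)
  qed
  then show ?thesis using F(1) by (metis ext)
qed

lemma backward_shift_decomposition:
  assumes f: "f \<in> H2" shows "f = disc_const (f 0) + disc_id * backward_shift f"
proof
  fix z show "f z = (disc_const (f 0) + disc_id * backward_shift f) z"
    by (cases "z \<in> disc") (use H2D(2)[OF f] in \<open>auto simp: disc_id_def backward_shift_def\<close>)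
qed

text \<open>
  Since \<open>|\<zeta>| = 1\<close> on the circle, multiplication by the coordinate is isometric, and its
  range is orthogonal to the constants.
\<close>

lemma backward_shift_adjoint:
  assumes f: "f \<in> H2" and k: "k \<in> H2"
  shows "H2_inner (backward_shift f) k = H2_inner f (disc_id * k)"
proof -
  let ?S = "backward_shift f"
  have S: "?S \<in> H2" by (rule backward_shift_H2[OF f])
  note zH = H2_mult[OF disc_id_Hinf S] H2_mult[OF disc_id_Hinf k]
  note [measurable] = bv_measurable[OF S] bv_measurable[OF k] bv_measurable[OF zH(1)] bv_measurable[OF zH(2)]
  have "H2_inner f (disc_id * k) = H2_inner (disc_const (f 0) + disc_id * ?S) (disc_id * k)"
    using backward_shift_decomposition[OF f] by simp
  also have "\<dots> = H2_inner (disc_id * ?S) (disc_id * k)"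
  proof -
    have "(disc_id * k) 0 = 0" by (simp add: disc_id_def)
    then show ?thesis by (simp add: H2_inner_add_left H2_inner_disc_const zH)
  qed
  also have "\<dots> = H2_inner ?S k"
    unfolding H2_inner_def L2_inner_def
  proof (rule integral_cong_AE)
    show "AE \<zeta> in circle. bv (disc_id * ?S) \<zeta> * cnj (bv (disc_id * k) \<zeta>) = bv ?S \<zeta> * cnj (bv k \<zeta>)"
      using bv_mult[OF disc_id_Hinf S] bv_mult[OF disc_id_Hinf k] bv_disc_id AE_circle_norm
    proof eventually_elim
      case (elim \<zeta>)
      have "bv (disc_id * ?S) \<zeta> * cnj (bv (disc_id * k) \<zeta>) = (\<zeta> * cnj \<zeta>) * (bv ?S \<zeta> * cnj (bv k \<zeta>))"
        using elim by (simp add: mult_ac)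
      also have "\<zeta> * cnj \<zeta> = 1" using complex_norm_square[of \<zeta>] elim by simp
      finally show ?case by (simp only: mult_1_left)
    qed
  qed auto
  finally show ?thesis by simp
qed

lemma backward_shift_0 [simp]: "backward_shift 0 = 0"
  by (simp add: backward_shift_def fun_eq_iff zero_fun_def)

lemma backward_shift_disc_const [simp]: "backward_shift (disc_const c) = 0"
proof -
  have "deriv (disc_const c) 0 = deriv (\<lambda>_. c) 0"
    by (rule deriv_cong_ev) (auto simp: disc_const_def eventually_nhds intro!: exI[of _ disc])
  then show ?thesis by (auto simp: backward_shift_def fun_eq_iff)
qed

text \<open>
  When \<open>f\<close> vanishes at the origin, the backward shift divides by the coordinate, and division
  commutes with multiplication by \<open>\<phi>\<close>.
\<close>

lemma backward_shift_mult:
  assumes \<phi>: "\<phi> holomorphic_on disc" and f: "f holomorphic_on disc" and "f 0 = 0"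
  shows "backward_shift (\<phi> * f) = \<phi> * backward_shift f"
proof -
  have "\<phi> field_differentiable at 0" "f field_differentiable at 0"
    using assms by (auto intro: holomorphic_on_imp_differentiable_at)
  then have "deriv (\<phi> * f) 0 = \<phi> 0 * deriv f 0"
    unfolding times_fun_def by (subst deriv_mult) (auto simp: \<open>f 0 = 0\<close>)
  then show ?thesis using \<open>f 0 = 0\<close> by (auto simp: backward_shift_def fun_eq_iff)
qed

text \<open>
  Both operators are adjoints of multiplications, by \<open>\<psi>\<close> and by the coordinate, and
  multiplications commute.
\<close>

theorem toeplitz_backward_shift:
  assumes \<sigma>: "\<sigma> \<in> borel_measurable borel" "AE \<zeta> in circle. \<sigma> \<zeta> = cnj (bv \<psi> \<zeta>)"
    and \<psi>: "\<psi> \<in> Hinf" and f: "f \<in> H2"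
  shows "toeplitz \<sigma> (backward_shift f) = backward_shift (toeplitz \<sigma> f)"
proof (rule H2_ext)
  note T = toeplitz_coanalytic[OF \<sigma> \<psi>]
  note S = backward_shift_H2[OF f]
  show "toeplitz \<sigma> (backward_shift f) \<in> H2" "backward_shift (toeplitz \<sigma> f) \<in> H2"
    by (intro T backward_shift_H2 f)+
  fix k assume k: "k \<in> H2"
  have "H2_inner (toeplitz \<sigma> (backward_shift f)) k = H2_inner f (disc_id * (\<psi> * k))"
    by (simp add: T(2)[OF S k] backward_shift_adjoint[OF f H2_mult[OF \<psi> k]])
  also have "\<dots> = H2_inner (toeplitz \<sigma> f) (disc_id * k)"
    by (simp add: T(2)[OF f H2_mult[OF disc_id_Hinf k]] mult.left_commute)
  also have "\<dots> = H2_inner (backward_shift (toeplitz \<sigma> f)) k"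
    by (rule backward_shift_adjoint[symmetric, OF T(1)[OF f] k])
  finally show "H2_inner (toeplitz \<sigma> (backward_shift f)) k = H2_inner (backward_shift (toeplitz \<sigma> f)) k" .
qed

section \<open>One-dimensional subspaces\<close>

text \<open>
  For a limit \<open>f\<close> of multiples of \<open>w\<close>, let \<open>p\<close> be its component orthogonal to \<open>w\<close>. All
  multiples of \<open>w\<close> are orthogonal to \<open>p\<close>, hence so is \<open>f\<close>; therefore \<open>p\<close> is orthogonal to
  itself. For \<open>w = 0\<close> division by zero makes \<open>p = f\<close>, and the argument still works.
\<close>

lemma H2_subspace_span:
  assumes w: "w \<in> H2" shows "H2_subspace (cfun.span {w})"
  unfolding H2_subspace_def
proof (intro conjI allI impI)
  show sub: "cfun.span {w} \<subseteq> H2" by (auto simp: cfun.span_singleton H2_cscale w)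
  show "cfun.subspace (cfun.span {w})" by (rule cfun.subspace_span)
  fix X f assume *: "(\<forall>n. X n \<in> cfun.span {w}) \<and> f \<in> H2 \<and> (\<lambda>n. H2_norm (X n - f)) \<longlonglongrightarrow> 0"
  then have f: "f \<in> H2" and X: "X n \<in> H2" for n using sub by auto
  let ?c = "H2_inner f w / H2_inner w w"
  let ?p = "f - cscale ?c w"
  have p: "?p \<in> H2" by (intro H2_diff H2_cscale f w)
  have wp: "H2_inner w ?p = 0"
  proof -
    have "H2_inner ?p w = 0"
      using H2_inner_self_eq_0[OF w]
      by (cases "H2_inner w w = 0")
        (simp_all add: H2_inner_diff_left H2_inner_cscale_left H2_cscale f w)
    then show ?thesis by (subst H2_inner_commute) simp
  qed
  have "(\<lambda>n. H2_inner (X n) ?p) \<longlonglongrightarrow> H2_inner f ?p"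
    by (rule H2_inner_tendsto[OF X f p]) (use * in blast)
  moreover have "H2_inner (X n) ?p = 0" for n
  proof -
    obtain c where "X n = cscale c w" using * by (auto simp: cfun.span_singleton)
    then show ?thesis by (simp only: H2_inner_cscale_left[OF w p] wp) simp
  qed
  ultimately have "H2_inner f ?p = 0" by (simp add: LIMSEQ_const_iff)
  then have "H2_inner ?p ?p = 0"
    using H2_inner_diff_left[OF f H2_cscale[OF w] p, of ?c]
    by (simp only: H2_inner_cscale_left[OF w p] wp) simp
  then have "?p = 0" by (rule H2_inner_self_eq_0[OF p])
  then show "f \<in> cfun.span {w}" by (auto simp: cfun.span_singleton)
qed

text \<open>
  On a line, orthogonality to the line determines the coefficient: it is the Fourier coefficient with
  respect to \<open>w\<close>.
\<close>

lemma proj_on_span: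
  assumes w: "w \<in> H2" "w \<noteq> 0" and f: "f \<in> H2"
  shows "proj_on (cfun.span {w}) f = cscale (H2_inner f w / of_real ((H2_norm w)\<^sup>2)) w"
proof -
  have ne: "H2_inner w w \<noteq> 0" using H2_inner_self_eq_0[OF w(1)] w(2) by blast
  have inner: "H2_inner (f - cscale c w) (cscale d w) = cnj d * (H2_inner f w - c * H2_inner w w)" for c d
    using w f by (simp add: H2_inner_diff_left H2_cscale H2_inner_cscale_right H2_inner_cscale_left right_diff_distrib)
  show ?thesis
    unfolding proj_on_def H2_inner_self[symmetric]
  proof (rule the_equality)
    let ?c = "H2_inner f w / H2_inner w w"
    show "cscale ?c w \<in> cfun.span {w} \<and> (\<forall>k\<in>cfun.span {w}. H2_inner (f - cscale ?c w) k = 0)"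
      using ne by (auto simp: cfun.span_singleton inner)
    fix h assume h: "h \<in> cfun.span {w} \<and> (\<forall>k\<in>cfun.span {w}. H2_inner (f - h) k = 0)"
    then obtain c where c: "h = cscale c w" by (auto simp: cfun.span_singleton)
    have "H2_inner (f - cscale c w) (cscale 1 w) = 0"
      using h unfolding c cfun.span_singleton by blast
    then have "H2_inner f w - c * H2_inner w w = 0" unfolding inner by simp
    then have "c = ?c" using ne by (simp add: field_simps)
    then show "h = cscale ?c w" by (simp add: c)
  qed
qed

lemma has_dim_span: "w \<noteq> 0 \<Longrightarrow> has_dim (cfun.span {w}) 1"
  unfolding has_dim_def by (intro exI[of _ "{w}"]) simp

lemma range_disc_const: "range disc_const = cfun.span {disc_const 1}"
proof -
  have "disc_const c = cscale c (disc_const 1)" for c by (simp add: disc_const_def cscale_def fun_eq_iff)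
  then show ?thesis unfolding cfun.span_singleton by (intro image_cong refl)
qed

lemma shift_invariant_constants: "shift_invariant (range disc_const)"
proof -
  have "0 \<in> range disc_const" unfolding range_disc_const by (rule cfun.span_zero)
  then have "backward_shift ` range disc_const \<subseteq> range disc_const" by auto
  then show ?thesis unfolding shift_invariant_def
    using H2_subspace_span[OF disc_const_H2[of 1]] by (simp only: range_disc_const)
qed

lemma shift2_invariant_constants: "shift2_invariant (range disc_const \<times> {0})"
proof -
  let ?C = "range disc_const"
  have C: "H2_subspace ?C"
    unfolding range_disc_const by (rule H2_subspace_span) simp
  then have sub: "cfun.subspace ?C" by (simp add: H2_subspace_def)
  have "H2xH2_subspace (?C \<times> {0})"
    unfolding H2xH2_subspace_def
  proof (intro conjI allI impI)
    show "?C \<times> {0} \<subseteq> H2 \<times> H2" by auto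
    show "cfun2.subspace (?C \<times> {0})"
      unfolding cfun2.subspace_def
      using cfun.subspace_0[OF sub] cfun.subspace_add[OF sub] cfun.subspace_scale[OF sub]
      by (auto simp: cscale2_def zero_prod_def)
    fix X Y f g
    assume *: "(\<forall>n. (X n, Y n) \<in> ?C \<times> {0}) \<and> f \<in> H2 \<and> g \<in> H2 \<and>
      (\<lambda>n. H2_norm (X n - f)) \<longlonglongrightarrow> 0 \<and> (\<lambda>n. H2_norm (Y n - g)) \<longlonglongrightarrow> 0"
    have "f \<in> ?C" using C * unfolding H2_subspace_def by blast
    moreover have "Y = (\<lambda>n. 0)" using * by auto
    then have "H2_norm (0 - g) = 0" using * by (simp add: LIMSEQ_const_iff)
    then have "0 - g = 0" using * H2_norm_eq_0[OF H2_diff[OF H2_0, of g]] by blast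
    ultimately show "(f, g) \<in> ?C \<times> {0}" by simp
  qed
  moreover have "map_prod backward_shift backward_shift ` (?C \<times> {0}) \<subseteq> ?C \<times> {0}"
    using cfun.subspace_0[OF sub] by auto
  ultimately show ?thesis by (simp only: shift2_invariant_def)
qed

text \<open>
  The factor \<open>d\<close> is the normalisation of the generator, which differs between the two
  cases of the final theorem.
\<close>

lemma span_eq_constant_multiples:
  assumes "w \<in> H2" "d \<noteq> 0"
  shows "cfun.span {w} = {f. \<exists>k\<in>range disc_const. f = k * cscale d w}"
proof -
  have "disc_const c * cscale d w = cscale (c * d) w" for c
    by (simp add: disc_const_mult_H2 H2_cscale assms)
  then have "range (\<lambda>c. cscale c w) = range (\<lambda>c. disc_const c * cscale d w)"
    using surj_def[of "\<lambda>c. c * d"] assms by (simp add: image_def) (metis nonzero_eq_divide_eq)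
  then show ?thesis unfolding cfun.span_singleton by auto
qed

section \<open>Kernels of rank-one perturbations\<close>

lemma coanalytic_inverse_symbol:
  assumes "Hinf_invertible f2"
  shows "(\<lambda>\<zeta>. inverse (cnj (bv f2 \<zeta>))) \<in> borel_measurable borel"
    and "AE \<zeta> in circle. inverse (cnj (bv f2 \<zeta>)) = cnj (bv (Hinf_inv f2) \<zeta>)"
proof -
  note [measurable] = bv_measurable[OF Hinf_H2[OF Hinf_inv_Hinf(3)[OF assms]]]
  show "(\<lambda>\<zeta>. inverse (cnj (bv f2 \<zeta>))) \<in> borel_measurable borel" by measurable
  show "AE \<zeta> in circle. inverse (cnj (bv f2 \<zeta>)) = cnj (bv (Hinf_inv f2) \<zeta>)"
    using bv_Hinf_inv[OF assms] by eventually_elim simp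
qed

text \<open>
  The operator with symbol \<open>f1 * cnj f2\<close> is multiplication by \<open>f1\<close> followed by the co-analytic
  operator with symbol \<open>cnj f2\<close>. Both factors are invertible; on adjoints, inverting the second one
  amounts to cancelling \<open>f2\<close> against its inverse.
\<close>

theorem toeplitz_invertible_symbol:
  assumes f1: "Hinf_invertible f1" and f2: "Hinf_invertible f2" and f: "f \<in> H2" and v: "v \<in> H2"
  defines "g \<equiv> \<lambda>\<zeta>. bv f1 \<zeta> * cnj (bv f2 \<zeta>)" and "s \<equiv> \<lambda>\<zeta>. inverse (cnj (bv f2 \<zeta>))"
  shows "toeplitz g f = v \<longleftrightarrow> f = Hinf_inv f1 * toeplitz s v"
proof -
  note F1 = Hinf_inv_Hinf[OF f1] and F2 = Hinf_inv_Hinf[OF f2]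
  note [measurable] = bv_measurable[OF Hinf_H2[OF F1(3)]] bv_measurable[OF Hinf_H2[OF F2(3)]]
  have Tg: "toeplitz g f \<in> H2" "\<And>k. k \<in> H2 \<Longrightarrow> H2_inner (toeplitz g f) k = H2_inner (f1 * f) (f2 * k)"
    by (rule toeplitz_adjoint[OF _ _ F1(3) F2(3) f]; simp add: g_def)+
  have Ts: "toeplitz s v \<in> H2"
    "\<And>k. k \<in> H2 \<Longrightarrow> H2_inner (toeplitz s v) k = H2_inner v (Hinf_inv f2 * k)"
    unfolding s_def
    by (rule toeplitz_coanalytic[OF coanalytic_inverse_symbol[OF f2] F2(1) v])
      (rule toeplitz_coanalytic(2)[OF coanalytic_inverse_symbol[OF f2] F2(1) v])
  have "toeplitz g f = v \<longleftrightarrow> f1 * f = toeplitz s v"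
  proof
    assume eq: "toeplitz g f = v"
    show "f1 * f = toeplitz s v"
    proof (rule H2_ext[OF H2_mult[OF F1(3) f] Ts(1)])
      fix k assume k: "k \<in> H2"
      then show "H2_inner (f1 * f) k = H2_inner (toeplitz s v) k"
        using Tg(2)[OF H2_mult[OF F2(1) k]] by (simp add: Ts(2) eq Hinf_inv_cancel[OF f2 k])
    qed
  next
    assume eq: "f1 * f = toeplitz s v"
    show "toeplitz g f = v"
    proof (rule H2_ext[OF Tg(1) v])
      fix k assume k: "k \<in> H2"
      then show "H2_inner (toeplitz g f) k = H2_inner v k"
        using Ts(2)[OF H2_mult[OF F2(3) k]] by (simp add: Tg(2) eq Hinf_inv_cancel[OF f2 k])
    qed
  qed
  also have "\<dots> \<longleftrightarrow> f = Hinf_inv f1 * toeplitz s v"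
    using Hinf_inv_cancel[OF f1 f] Hinf_inv_cancel[OF f1 Ts(1)] by metis
  finally show ?thesis .
qed

theorem corollary3p6:
  fixes f1 f2 u v g s w w' :: "complex \<Rightarrow> complex"
    and R1 :: "(complex \<Rightarrow> complex) \<Rightarrow> complex \<Rightarrow> complex"
    and M :: "(complex \<Rightarrow> complex) set"
    and a b :: "nat \<Rightarrow> complex"
  assumes f1: "Hinf_invertible f1" and f2: "Hinf_invertible f2"
    and g: "g = (\<lambda>\<zeta>. bv f1 \<zeta> * cnj (bv f2 \<zeta>))"
    and u: "u \<in> H2" and v: "v \<in> H2" and norm_u: "H2_norm u = 1"
    and Sv: "backward_shift v \<noteq> 0"
    and R1: "R1 = (\<lambda>f. toeplitz g f + cscale (H2_inner f u) v)"
    and s: "s = (\<lambda>\<zeta>. inverse (cnj (bv f2 \<zeta>)))"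
    and w: "w = Hinf_inv f1 * toeplitz s v"
    and w': "w' = Hinf_inv f1 * toeplitz s (backward_shift v)"
    and cond: "1 + H2_inner w u = 0"
    and M: "M = {f \<in> H2. R1 f = 0}"
    and a: "a = taylor_coeff (toeplitz s v)"
    and b: "b = taylor_coeff (Hinf_inv f1)"
  shows "M = cfun.span {w} \<and> nearly_invariant 1 M \<and> defect_space 1 M (cfun.span {w'}) \<and>
    (a 0 * b 0 \<noteq> 0 \<longrightarrow>
      (let f0 = proj_on M (disc_const 1); K = range disc_const \<times> {0} in
        f0 = cscale (cnj (a 0 * b 0) / of_real ((H2_norm w)\<^sup>2)) w \<and>
        shift2_invariant K \<and>
        M = {f. \<exists>k0. f = k0 * f0 \<and> (k0, 0) \<in> K})) \<and>
    (a 0 * b 0 = 0 \<longrightarrow>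
      (let K = range disc_const in
        shift_invariant K \<and>
        M = {f. \<exists>k1\<in>K. f = k1 * cscale (1 / of_real (H2_norm w')) w}))"
proof -
  note F1 = Hinf_inv_Hinf[OF f1] and F2 = Hinf_inv_Hinf[OF f2]
  have sym: "s \<in> borel_measurable borel" "AE \<zeta> in circle. s \<zeta> = cnj (bv (Hinf_inv f2) \<zeta>)"
    "Hinf_inv f2 \<in> Hinf"
    unfolding s by (intro coanalytic_inverse_symbol f2 F2)+
  note Sv2 = backward_shift_H2[OF v]
  have t: "toeplitz s v \<in> H2" by (rule toeplitz_coanalytic(1)[OF sym v])
  have t': "toeplitz s (backward_shift v) \<in> H2" by (rule toeplitz_coanalytic(1)[OF sym Sv2])
  have wH: "w \<in> H2" and w'H: "w' \<in> H2"
    unfolding w w' by (intro H2_mult F1 t t')+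
  have w0: "w \<noteq> 0" using cond u by auto
  have solve: "toeplitz g f = x \<longleftrightarrow> f = Hinf_inv f1 * toeplitz s x" if "f \<in> H2" "x \<in> H2" for f x
    unfolding g s by (rule toeplitz_invertible_symbol[OF f1 f2 that])
  have ws: "Hinf_inv f1 * toeplitz s (cscale c v) = cscale c w" for c
    unfolding w toeplitz_cscale[OF sym v] by (simp add: cscale_def fun_eq_iff)

  \<comment> \<open>Solving with the invertible Toeplitz operator leaves a scalar unknown, \<open>H2_inner f u\<close>.\<close>
  have R1_iff: "R1 f = 0 \<longleftrightarrow> f = cscale (- H2_inner f u) w" if f: "f \<in> H2" for f
  proof -
    have "R1 f = 0 \<longleftrightarrow> toeplitz g f = cscale (- H2_inner f u) v"
      unfolding R1 by (simp add: add_eq_0_iff2)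
    also have "\<dots> \<longleftrightarrow> f = cscale (- H2_inner f u) w"
      unfolding solve[OF f H2_cscale[OF v]] ws ..
    finally show ?thesis .
  qed
  have wu: "H2_inner w u = -1" using cond by (simp add: add_eq_0_iff)
  \<comment> \<open>The hypothesis on \<open>w\<close> says precisely that each multiple of \<open>w\<close> is consistent with its own
    value of that scalar.\<close>
  have M_span: "M = cfun.span {w}"
  proof
    show "M \<subseteq> cfun.span {w}" unfolding M cfun.span_singleton using R1_iff by blast
    show "cfun.span {w} \<subseteq> M"
      by (auto simp: M cfun.span_singleton R1_iff H2_cscale wH H2_inner_cscale_left u wu)
  qed

  \<comment> \<open>The Toeplitz operator maps \<open>w'\<close> to the backward shift of \<open>v\<close>, which is not zero.\<close>
  have w'0: "w' \<noteq> 0"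
  proof
    assume "w' = 0"
    then have "toeplitz g 0 = backward_shift v" using solve[OF H2_0 Sv2] w' by simp
    moreover have "toeplitz g 0 = 0"
      using solve[OF H2_0 H2_0] ws[of 0] by simp
    ultimately show False using Sv by simp
  qed
  have Sw: "backward_shift w = w'" if "w 0 = 0"
  proof -
    have "Hinf_inv f1 0 * f1 0 = 1"
      using fun_cong[OF F1(2), of 0] by (simp add: mult.commute)
    then have "toeplitz s v 0 = 0" using that by (auto simp: w)
    then show ?thesis
      unfolding w w' toeplitz_backward_shift[OF sym v]
      by (intro backward_shift_mult H2D(1) t Hinf_H2 F1)
  qed
  have Scale: "backward_shift (cscale c w) = cscale c (backward_shift w)" if "w 0 = 0" for c
  proof -
    have "backward_shift (disc_const c * w) = disc_const c * backward_shift w"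
      by (intro backward_shift_mult H2D(1) disc_const_H2 wH that)
    then show ?thesis by (simp add: disc_const_mult_H2 wH backward_shift_H2)
  qed
  have defect: "defect_space 1 M (cfun.span {w'})"
    unfolding defect_space_def
  proof (intro conjI ballI impI)
    show "H2_subspace (cfun.span {w'})" by (rule H2_subspace_span[OF w'H])
    show "has_dim (cfun.span {w'}) 1" by (rule has_dim_span[OF w'0])
    fix f assume "f \<in> M" and f0: "f 0 = 0"
    then obtain c where c: "f = cscale c w" by (auto simp: M_span cfun.span_singleton)
    have "backward_shift f = cscale c w'"
    proof (cases "c = 0")
      case False
      then have "w 0 = 0" using f0 by (simp add: c cscale_def)
      then show ?thesis by (simp add: c Scale Sw)
    qed (simp add: c)
    moreover have "cscale c w' \<in> cfun.span {w'}" by (auto simp: cfun.span_singleton)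
    moreover have "0 \<in> M" unfolding M_span by (rule cfun.span_zero)
    ultimately show "\<exists>h\<in>M. \<exists>k\<in>cfun.span {w'}. backward_shift f = h + k"
      by (intro bexI[of _ 0] bexI[of _ "cscale c w'"]) simp_all
  qed
  then have nearly: "nearly_invariant 1 M"
    unfolding nearly_invariant_def M_span using H2_subspace_span[OF wH] by blast

  \<comment> \<open>The case distinction is about whether \<open>w\<close> vanishes at the origin.\<close>
  have wab: "w 0 = a 0 * b 0" by (simp add: w a b mult.commute)
  have f0: "proj_on M (disc_const 1) = cscale (cnj (a 0 * b 0) / of_real ((H2_norm w)\<^sup>2)) w"
    unfolding M_span proj_on_span[OF wH w0 disc_const_H2] H2_inner_disc_const[OF wH] wab by simp
  have M1: "M = {f. \<exists>k0. f = k0 * proj_on M (disc_const 1) \<and> (k0, 0) \<in> range disc_const \<times> {0}}"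
    if "a 0 * b 0 \<noteq> 0"
  proof -
    have "cnj (a 0 * b 0) / of_real ((H2_norm w)\<^sup>2) \<noteq> 0"
      using that H2_norm_eq_0[OF wH] w0 by simp
    from span_eq_constant_multiples[OF wH this] show ?thesis
      unfolding f0 by (subst M_span) auto
  qed
  have M2: "M = {f. \<exists>k1\<in>range disc_const. f = k1 * cscale (1 / of_real (H2_norm w')) w}"
    unfolding M_span using H2_norm_eq_0[OF w'H] w'0 by (intro span_eq_constant_multiples wH) simp
  show ?thesis
    unfolding Let_def
    using M_span nearly defect f0 M1 M2 shift_invariant_constants shift2_invariant_constants
    by (intro conjI impI) blast+
qed

end
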